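(* There is an absolute constant $C$ such that for every $d\ge 2$ and every convex body $K\subset\mathbb{R}^d$ with $o\in\mathrm{int}(K)$, \[\kappa'(K,o)\le\kappa(K,o)\le P\!\left(K,2\left(1+\tfrac1d\right)\right)(d+C)\bigl(\log d+\log\theta(K,o)\bigr).\] Moreover, if $c$ is the centroid of $K$, then \[\kappa(K,c)\le P\!\left(K-c,2\left(1+\tfrac1d\right)\right)(2d+C)\log d.\]
   Context: A convex body is a compact convex set with non-empty interior. For a convex body $L$ with $o\in\mathrm{int}(L)$, $\|x\|_L=\inf\{\mu>0:x\in\mu L\}$. $P(K,\lambda)$ (for $o\in\mathrm{int}K$) is the maximum number of points $p_1,\dots,p_m$ such that $\max_{i<j}\|p_i-p_j\|_{\frac12(K-K)}\big/\min_{i<j}\|p_i-p_j\|_{K\cap-K}\le\lambda$. For $p\in\mathrm{int}(K)$, a Minkowski arrangement of $K$ with respect to $p$ is a family $\{v_i+\lambda_iK\}$ ($\lambda_i>0$, $v_i\in\mathbb{R}^d$) with $v_i+p\notin v_j+\lambda_j\,\mathrm{int}(K)$ for distinct $i,j$; it is strict if $v_i+p\notin v_j+\lambda_jK$ for distinct $i,j$. $\kappa(K,p)$ (resp. $\kappa'(K,p)$) is the largest size of a pairwise intersecting Minkowski (resp. strict Minkowski) arrangement of $K$ with respect to $p$. $\theta(K,p)=\inf\{\theta:p-K\subseteq\theta(K-p)\}$.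
   Formalization: In a Minkowski arrangement with respect to p, the condition uses v_i + λ_i p instead of v_i + p (with v_i + p, κ(K,c) is infinite whenever c ≠ o); and θ(K,p) is the infimum over positive θ only, since all θ ≤ −1 would otherwise qualify. *)

theory Defs
  imports "HOL-Analysis.Analysis" "HOL-Probability.Probability"
begin

text \<open>Points of R^d are encoded uniformly in d as functions nat => real that
vanish at every index >= d.  This lets the absolute constant C be quantified
before the dimension d.\<close>

type_synonym vec = "nat \<Rightarrow> real"

definition Rd :: "nat \<Rightarrow> vec set" where
  "Rd d = {x. \<forall>i\<ge>d. x i = 0}"

definition vadd :: "vec \<Rightarrow> vec \<Rightarrow> vec" where "vadd x y = (\<lambda>i. x i + y i)"
definition vsub :: "vec \<Rightarrow> vec \<Rightarrow> vec" where "vsub x y = (\<lambda>i. x i - y i)"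
definition vscale :: "real \<Rightarrow> vec \<Rightarrow> vec" where "vscale t x = (\<lambda>i. t * x i)"
definition origin :: vec where "origin = (\<lambda>i. 0)"

definition enorm :: "nat \<Rightarrow> vec \<Rightarrow> real" where
  "enorm d x = sqrt (\<Sum>i<d. (x i)\<^sup>2)"

definition interior_d :: "nat \<Rightarrow> vec set \<Rightarrow> vec set" where
  "interior_d d K = {x \<in> Rd d. \<exists>r>0. {y \<in> Rd d. enorm d (vsub y x) < r} \<subseteq> K}"

definition closed_d :: "nat \<Rightarrow> vec set \<Rightarrow> bool" where
  "closed_d d K \<longleftrightarrow> (\<forall>x \<in> Rd d. (\<forall>r>0. \<exists>y\<in>K. enorm d (vsub y x) < r) \<longrightarrow> x \<in> K)"

definition bounded_d :: "nat \<Rightarrow> vec set \<Rightarrow> bool" where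
  "bounded_d d K \<longleftrightarrow> (\<exists>R. \<forall>x\<in>K. enorm d x \<le> R)"

definition convex_set :: "vec set \<Rightarrow> bool" where
  "convex_set K \<longleftrightarrow> (\<forall>x\<in>K. \<forall>y\<in>K. \<forall>t::real. 0 \<le> t \<and> t \<le> 1 \<longrightarrow>
      vadd (vscale (1 - t) x) (vscale t y) \<in> K)"

definition convex_body :: "nat \<Rightarrow> vec set \<Rightarrow> bool" where
  "convex_body d K \<longleftrightarrow> K \<subseteq> Rd d \<and> convex_set K \<and> closed_d d K \<and> bounded_d d K
      \<and> interior_d d K \<noteq> {}"

definition set_scale :: "real \<Rightarrow> vec set \<Rightarrow> vec set" where
  "set_scale t L = vscale t ` L"

definition translate :: "vec \<Rightarrow> vec set \<Rightarrow> vec set" where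
  "translate v L = vadd v ` L"

definition gauge :: "vec set \<Rightarrow> vec \<Rightarrow> real" where
  "gauge L x = Inf {\<mu>. \<mu> > 0 \<and> x \<in> set_scale \<mu> L}"

definition half_diff :: "vec set \<Rightarrow> vec set" where
  "half_diff K = {vscale (1/2) (vsub a b) | a b. a \<in> K \<and> b \<in> K}"

definition sym_core :: "vec set \<Rightarrow> vec set" where
  "sym_core K = K \<inter> vscale (-1) ` K"

definition P_num :: "nat \<Rightarrow> vec set \<Rightarrow> real \<Rightarrow> nat" where
  "P_num d K lam = Sup {m. \<exists>p :: nat \<Rightarrow> vec. inj_on p {..<m} \<and> (\<forall>i<m. p i \<in> Rd d) \<and>
     (\<forall>i<m. \<forall>j<m. \<forall>k<m. \<forall>l<m. i \<noteq> j \<and> k \<noteq> l \<longrightarrow>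
        gauge (half_diff K) (vsub (p i) (p j)) \<le> lam * gauge (sym_core K) (vsub (p k) (p l)))}"

definition minkowski_arr :: "nat \<Rightarrow> vec set \<Rightarrow> vec \<Rightarrow> nat \<Rightarrow> (nat \<Rightarrow> vec) \<Rightarrow> (nat \<Rightarrow> real) \<Rightarrow> bool" where
  "minkowski_arr d K p m v lam \<longleftrightarrow> (\<forall>i<m. lam i > 0 \<and> v i \<in> Rd d) \<and>
     (\<forall>i<m. \<forall>j<m. i \<noteq> j \<longrightarrow>
        vadd (v i) (vscale (lam i) p) \<notin> translate (v j) (set_scale (lam j) (interior_d d K)))"

definition strict_minkowski_arr :: "nat \<Rightarrow> vec set \<Rightarrow> vec \<Rightarrow> nat \<Rightarrow> (nat \<Rightarrow> vec) \<Rightarrow> (nat \<Rightarrow> real) \<Rightarrow> bool" where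
  "strict_minkowski_arr d K p m v lam \<longleftrightarrow> (\<forall>i<m. lam i > 0 \<and> v i \<in> Rd d) \<and>
     (\<forall>i<m. \<forall>j<m. i \<noteq> j \<longrightarrow>
        vadd (v i) (vscale (lam i) p) \<notin> translate (v j) (set_scale (lam j) K))"

definition pairwise_intersecting :: "vec set \<Rightarrow> nat \<Rightarrow> (nat \<Rightarrow> vec) \<Rightarrow> (nat \<Rightarrow> real) \<Rightarrow> bool" where
  "pairwise_intersecting K m v lam \<longleftrightarrow> (\<forall>i<m. \<forall>j<m.
     translate (v i) (set_scale (lam i) K) \<inter> translate (v j) (set_scale (lam j) K) \<noteq> {})"

definition kappa :: "nat \<Rightarrow> vec set \<Rightarrow> vec \<Rightarrow> nat" where
  "kappa d K p = Sup {m. \<exists>v lam. minkowski_arr d K p m v lam \<and> pairwise_intersecting K m v lam}"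

definition kappa' :: "nat \<Rightarrow> vec set \<Rightarrow> vec \<Rightarrow> nat" where
  "kappa' d K p = Sup {m. \<exists>v lam. strict_minkowski_arr d K p m v lam \<and> pairwise_intersecting K m v lam}"

definition theta :: "vec set \<Rightarrow> vec \<Rightarrow> real" where
  "theta K p = Inf {t. t > 0 \<and> (\<lambda>x. vsub p x) ` K \<subseteq> set_scale t ((\<lambda>x. vsub x p) ` K)}"

text \<open>Lebesgue measure on R^d: the product of d copies of lborel on {..<d};
a point of R^d is identified with its restriction to {..<d}.\<close>
definition leb_d :: "nat \<Rightarrow> (nat \<Rightarrow> real) measure" where
  "leb_d d = PiM {..<d} (\<lambda>_. lborel)"

definition ext0 :: "nat \<Rightarrow> (nat \<Rightarrow> real) \<Rightarrow> vec" where
  "ext0 d x = (\<lambda>i. if i < d then x i else 0)"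

definition region_d :: "nat \<Rightarrow> vec set \<Rightarrow> (nat \<Rightarrow> real) set" where
  "region_d d K = {x \<in> space (leb_d d). ext0 d x \<in> K}"

definition centroid :: "nat \<Rightarrow> vec set \<Rightarrow> vec" where
  "centroid d K = (\<lambda>i. if i < d then
      (\<integral>x. indicator (region_d d K) x * x i \<partial>leb_d d) / measure (leb_d d) (region_d d K)
      else 0)"

end

theory Submission
  imports Defs
begin

text \<open>Write \<open>q = 1 + 1/d\<close> and let \<open>s\<close> be the least ratio of the arrangement. The homothets with ratio in
  \<open>[s q\<^sup>k, s q\<^sup>k\<^sup>+\<^sup>1]\<close> have centres forming a configuration for \<open>P\<close>. If \<open>- K \<subseteq> t K\<close>, all homothets with
  ratio at least \<open>d t s\<close> together give one more such configuration, after their centres are rescaled.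
  About \<open>(d + 1) ln (d t)\<close> groups remain. The first bound takes \<open>t\<close> slightly above
  \<open>\<theta>(K, o)\<close>; the second uses that \<open>t = d\<close> is admissible when the centroid is the origin.\<close>

subsection \<open>Bodies in coordinates\<close>

text \<open>The parameter 2(1 + 1/d) fits both kinds of group. When ratios lie between s' and q s',
  centres are at most 2 q s' apart for the half-difference body and at least s' apart for the
  symmetric core. In the large group the rescaled distances are at most 2 and at least lam / (lam +
  t s), and d t s is the value of lam at which this quotient reaches d/(d + 1) = 1/q. That t = d
  works at the centroid is Minkowski's asymmetry inequality. Its proof needs the mean of a linear
  form over a body, hence a change of variables under homotheties and a separating functional.
  \<open>P_num\<close> and \<open>kappa\<close> are suprema of sets of naturals, which say nothing
  unless those sets are bounded, so finiteness is proved along the way; likewise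
  \<open>gauge\<close> and \<open>theta\<close> are infima of sets that must be shown
  nonempty.\<close>

lemma enorm_eq_L2_set: "enorm d x = L2_set x {..<d}"
  by (simp add: enorm_def L2_set_def)

lemma abs_coord_le_enorm: "i < d \<Longrightarrow> \<bar>x i\<bar> \<le> enorm d x"
  using member_le_L2_set[of "{..<d}" i "\<lambda>i. \<bar>x i\<bar>"]
  by (simp add: enorm_eq_L2_set L2_set_def)

lemma enorm_le_sup:
  assumes "\<And>i. i < d \<Longrightarrow> \<bar>x i\<bar> \<le> s"
  shows "enorm d x \<le> real d * s"
proof -
  have "enorm d x \<le> (\<Sum>i<d. \<bar>x i\<bar>)"
    unfolding enorm_eq_L2_set by (rule L2_set_le_sum_abs)
  also have "\<dots> \<le> (\<Sum>i<d. s)" using assms by (intro sum_mono) auto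
  finally show ?thesis by simp
qed

lemma enorm_scale: "enorm d (\<lambda>i. t * x i) = \<bar>t\<bar> * enorm d x"
  by (simp add: enorm_def power_mult_distrib sum_distrib_left[symmetric] real_sqrt_mult)

lemma convex_setD:
  assumes "convex_set K" "x \<in> K" "y \<in> K" "0 \<le> t" "t \<le> 1"
  shows "(\<lambda>i. (1 - t) * x i + t * y i) \<in> K"
  using assms unfolding convex_set_def vadd_def vscale_def by blast

lemma set_scale_iff:
  assumes "t > 0"
  shows "x \<in> set_scale t L \<longleftrightarrow> (\<lambda>i. x i / t) \<in> L"
proof
  assume "x \<in> set_scale t L"
  then show "(\<lambda>i. x i / t) \<in> L" using assms by (auto simp: set_scale_def vscale_def)
next
  assume "(\<lambda>i. x i / t) \<in> L"
  moreover have "x = vscale t (\<lambda>i. x i / t)" using assms by (simp add: vscale_def)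
  ultimately show "x \<in> set_scale t L" unfolding set_scale_def by blast
qed

lemma translate_iff: "x \<in> translate v L \<longleftrightarrow> (\<lambda>i. x i - v i) \<in> L"
proof
  assume "x \<in> translate v L"
  then show "(\<lambda>i. x i - v i) \<in> L" by (auto simp: translate_def vadd_def)
next
  assume "(\<lambda>i. x i - v i) \<in> L"
  moreover have "x = vadd v (\<lambda>i. x i - v i)" by (simp add: vadd_def)
  ultimately show "x \<in> translate v L" unfolding translate_def by blast
qed

section \<open>Compactness of bodies and separation by a linear functional\<close>

lemma continuous_on_enorm_diff: "continuous_on UNIV (\<lambda>y::vec. enorm d (vsub y x))"
  unfolding enorm_def vsub_def
  by (intro continuous_intros continuous_on_product_coordinates)

text \<open>\<open>closed\<close> refers to the product topology on \<open>nat => real\<close>.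
  Vanishing beyond d is a closed condition there, and Euclidean balls around a point are open
  because \<open>enorm\<close> reads only finitely many coordinates.\<close>

lemma closed_of_closed_d:
  assumes "closed_d d K" "K \<subseteq> Rd d"
  shows "closed K"
proof -
  have "x \<in> K" if x: "x \<in> closure K" for x
  proof -
    have "x i = 0" if "i \<ge> d" for i
    proof -
      have "closed {y::vec. y i = 0}"
        by (intro closed_Collect_eq continuous_on_product_coordinates continuous_intros)
      moreover have "K \<subseteq> {y. y i = 0}" using assms(2) that by (auto simp: Rd_def)
      ultimately have "closure K \<subseteq> {y. y i = 0}" by (rule closure_minimal[rotated])
      then show ?thesis using x by blast
    qed
    then have "x \<in> Rd d" by (simp add: Rd_def)
    moreover have "\<exists>y\<in>K. enorm d (vsub y x) < r" if "r > 0" for r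
    proof -
      let ?U = "{y::vec. enorm d (vsub y x) < r}"
      have "open ?U" by (rule open_Collect_less[OF continuous_on_enorm_diff continuous_on_const])
      moreover have "x \<in> ?U" using that by (simp add: enorm_def vsub_def)
      ultimately show ?thesis using x open_Int_closure_eq_empty[of ?U K] by blast
    qed
    ultimately show "x \<in> K" using assms(1) by (auto simp: closed_d_def)
  qed
  then show ?thesis using closure_subset_eq by blast
qed

lemma bounded_dD:
  assumes "bounded_d d K" "K \<subseteq> Rd d"
  obtains R where "R > 0" "\<And>x i. x \<in> K \<Longrightarrow> \<bar>x i\<bar> \<le> R"
proof -
  obtain R where R: "\<And>x. x \<in> K \<Longrightarrow> enorm d x \<le> R" using assms(1) by (auto simp: bounded_d_def)
  have "\<bar>x i\<bar> \<le> max R 1" if "x \<in> K" for x i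
    using abs_coord_le_enorm[of i d x] R[OF that] assms(2) that
    by (cases "i < d") (auto simp: Rd_def subset_iff)
  then show thesis by (intro that[of "max R 1"]) auto
qed

lemma compact_of_convex_body:
  assumes "convex_body d K"
  shows "compact K"
proof -
  have K: "closed_d d K" "bounded_d d K" "K \<subseteq> Rd d" using assms by (auto simp: convex_body_def)
  obtain R where R: "R > 0" "\<And>x i. x \<in> K \<Longrightarrow> \<bar>x i\<bar> \<le> R" using bounded_dD K by metis
  have "compactin (product_topology (\<lambda>_. euclidean) UNIV) (PiE UNIV (\<lambda>_::nat. {-R..R}))"
    unfolding compactin_PiE by simp
  then have "compact (PiE UNIV (\<lambda>_::nat. {-R..R}))"
    by (simp add: euclidean_product_topology)
  moreover have "K \<subseteq> PiE UNIV (\<lambda>_. {-R..R})"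
  proof
    fix x assume "x \<in> K"
    then have "- R \<le> x i \<and> x i \<le> R" for i using R(2)[of x i] by (simp add: abs_le_iff)
    then show "x \<in> PiE UNIV (\<lambda>_. {-R..R})" by (simp add: PiE_UNIV_domain)
  qed
  ultimately show ?thesis using closed_of_closed_d[OF K(1,3)]
    by (metis compact_Int_closed inf.absorb_iff2)
qed

text \<open>The functional is z - p with p the point of K nearest to z, and b is its value at
  p.\<close>

lemma separation:
  assumes K: "convex_body d K" and z: "z \<in> Rd d" "z \<notin> K"
  shows "\<exists>a b. (\<forall>x\<in>K. (\<Sum>i<d. a i * x i) \<le> b) \<and> b < (\<Sum>i<d. a i * z i)"
proof -
  let ?D = "\<lambda>x. \<Sum>i<d. (z i - x i)\<^sup>2"
  have "interior_d d K \<noteq> {}" using K by (auto simp: convex_body_def)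
  then have "K \<noteq> {}"
    by (force simp: interior_d_def enorm_def vsub_def)
  moreover have "continuous_on K ?D"
    by (rule continuous_on_subset[of UNIV])
       (auto intro!: continuous_intros continuous_on_product_coordinates)
  ultimately have "\<exists>p\<in>K. \<forall>x\<in>K. ?D p \<le> ?D x"
    by (rule continuous_attains_inf[OF compact_of_convex_body[OF K]])
  then obtain p where p: "p \<in> K" "\<And>x. x \<in> K \<Longrightarrow> ?D p \<le> ?D x" by blast
  define a where "a i = z i - p i" for i
  have conv: "convex_set K" and sub: "K \<subseteq> Rd d" using K by (auto simp: convex_body_def)
  have "(\<Sum>i<d. a i * x i) \<le> (\<Sum>i<d. a i * p i)" if x: "x \<in> K" for x
  proof -
    define B where "B = (\<Sum>i<d. a i * (x i - p i))"
    define E where "E = (\<Sum>i<d. (x i - p i)\<^sup>2)"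
    \<comment> \<open>Moving from p towards x by t cannot bring the point closer to z. Expanding the
      squares and dividing by t gives the inequality; the limit t to 0 leaves B at most 0.\<close>
    have "2 * B \<le> t * E" if t: "0 < t" "t \<le> 1" for t
    proof -
      have "?D p \<le> ?D (\<lambda>i. (1 - t) * p i + t * x i)"
        using convex_setD[OF conv p(1) x] t by (intro p(2)) auto
      also have "\<dots> = (\<Sum>i<d. (z i - p i)\<^sup>2 - 2 * t * (a i * (x i - p i)) + t\<^sup>2 * (x i - p i)\<^sup>2)"
        by (intro sum.cong refl) (simp add: a_def power2_eq_square algebra_simps)
      also have "\<dots> = ?D p - 2 * t * B + t\<^sup>2 * E"
        by (simp add: B_def E_def sum.distrib sum_subtractf sum_distrib_left)
      finally have "t * (2 * B) \<le> t * (t * E)" by (simp add: power2_eq_square algebra_simps)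
      then show ?thesis using t by simp
    qed
    then have "2 * B \<le> 0"
    proof -
      have "((\<lambda>t. t * E) \<longlongrightarrow> 0 * E) (at_right (0::real))" by (intro tendsto_intros)
      moreover have "eventually (\<lambda>t::real. 0 < t \<and> t \<le> 1) (at_right 0)"
        unfolding eventually_at_right_field by (intro exI[of _ 1]) auto
      then have "eventually (\<lambda>t. 2 * B \<le> t * E) (at_right (0::real))"
        by eventually_elim (use \<open>\<And>t. 0 < t \<Longrightarrow> t \<le> 1 \<Longrightarrow> 2 * B \<le> t * E\<close> in auto)
      ultimately show ?thesis using tendsto_lowerbound[of "\<lambda>t. t * E"] by simp
    qed
    then show ?thesis by (simp add: B_def algebra_simps sum_subtractf)
  qed
  moreover have "(\<Sum>i<d. a i * p i) < (\<Sum>i<d. a i * z i)"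
  proof -
    have "\<exists>i<d. a i \<noteq> 0"
    proof (rule ccontr)
      assume "\<not> ?thesis"
      then have "z i = p i" for i using z(1) p(1) sub by (cases "i < d") (auto simp: a_def Rd_def)
      then show False using z(2) p(1) by (metis ext)
    qed
    then obtain i where i: "i < d" "a i \<noteq> 0" by auto
    have "0 < (\<Sum>i<d. a i * a i)" by (rule sum_pos2[of _ i]) (use i in \<open>auto simp: zero_less_mult_iff\<close>)
    also have "\<dots> = (\<Sum>i<d. a i * (z i - p i))" by (simp add: a_def)
    finally show ?thesis by (simp add: right_diff_distrib sum_subtractf)
  qed
  ultimately show ?thesis by blast
qed

subsection \<open>The centroid\<close>

interpretation lborel_vec: product_sigma_finite "\<lambda>_::nat. lborel :: real measure"
  by standard

lemma coord_measurable: "i < d \<Longrightarrow> (\<lambda>x. x i) \<in> borel_measurable (leb_d d)"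
  using measurable_component_singleton[of i "{..<d}" "\<lambda>_. lborel :: real measure"]
  by (simp add: leb_d_def)

text \<open>With countably many coordinates the product sigma-algebra is the Borel one of the
  product topology, so a closed K has a measurable \<open>region_d\<close>.\<close>

lemma ext0_measurable: "ext0 d \<in> measurable (leb_d d) borel"
proof -
  have "ext0 d \<in> measurable (leb_d d) (PiM UNIV (\<lambda>_::nat. borel :: real measure))"
    unfolding ext0_def
  proof (rule measurable_PiM_single')
    fix i
    show "(\<lambda>x. if i < d then x i else 0) \<in> borel_measurable (leb_d d)"
      using coord_measurable by (cases "i < d") auto
  qed auto
  then show ?thesis
    using measurable_cong_sets[OF refl sets_PiM_equal_borel] by blast
qed

lemma region_d_sets:
  assumes "convex_body d K"
  shows "region_d d K \<in> sets (leb_d d)"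
proof -
  have "K \<in> sets borel"
    using assms closed_of_closed_d by (intro borel_closed) (auto simp: convex_body_def)
  from measurable_sets[OF ext0_measurable[of d] this] show ?thesis
    by (simp add: region_d_def vimage_def Int_def conj_commute)
qed

text \<open>Restricted to \<open>{..<d}\<close> because points of \<open>leb_d d\<close> are
  \<open>undefined\<close> at all other indices.\<close>

definition homothety :: "nat \<Rightarrow> vec \<Rightarrow> real \<Rightarrow> vec \<Rightarrow> vec" where
  "homothety d a s x = (\<lambda>i\<in>{..<d}. a i + s * (x i - a i))"

lemma homothety_measurable: "homothety d a s \<in> measurable (leb_d d) (leb_d d)"
  unfolding homothety_def
  by (subst (2) leb_d_def, rule measurable_restrict)
     (use coord_measurable[of _ d] in measurable)

text \<open>Boxes determine the product measure, and on a box each of the d coordinates contributes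
  one factor s by the affine transformation rule for \<open>lborel\<close>.\<close>

lemma distr_homothety:
  assumes "s > 0"
  shows "density (distr (leb_d d) (leb_d d) (homothety d a s)) (\<lambda>_. ennreal (s ^ d)) = leb_d d"
    (is "?P = _")
proof -
  have "?P = PiM {..<d} (\<lambda>_. lborel)"
  proof (rule lborel_vec.PiM_eqI)
    fix A :: "nat \<Rightarrow> real set"
    assume A: "\<And>i. i \<in> {..<d} \<Longrightarrow> A i \<in> sets lborel"
    have PA: "PiE {..<d} A \<in> sets (leb_d d)"
      unfolding leb_d_def using A by (intro sets_PiM_I_finite) auto
    let ?B = "\<lambda>i. (\<lambda>y. a i + s * (y - a i)) -` A i"
    have B: "?B i \<in> sets borel" if "i < d" for i
      using measurable_sets[of "\<lambda>y. a i + s * (y - a i)" borel borel "A i"] A[of i] that by simp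
    have 1: "ennreal s * emeasure lborel (?B i) = emeasure lborel (A i)" if "i < d" for i
    proof -
      let ?D = "distr lborel borel (\<lambda>y. (a i - s * a i) + s * y)"
      have Ai: "A i \<in> sets borel" using A[of i] that by simp
      have "emeasure lborel (A i) = emeasure (density ?D (\<lambda>_. ennreal \<bar>s\<bar>)) (A i)"
        using assms lborel_real_affine[of s "a i - s * a i"] by simp
      also have "\<dots> = ennreal s * emeasure ?D (A i)"
        using assms Ai by (subst emeasure_density_const) auto
      also have "emeasure ?D (A i) = emeasure lborel (?B i)"
        using Ai by (subst emeasure_distr) (auto simp: vimage_def algebra_simps)
      finally show ?thesis by simp
    qed
    have "homothety d a s -` PiE {..<d} A \<inter> space (leb_d d) = PiE {..<d} ?B"
      by (auto simp: homothety_def leb_d_def space_PiM PiE_iff)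
    then have "emeasure (distr (leb_d d) (leb_d d) (homothety d a s)) (PiE {..<d} A)
        = (\<Prod>i<d. emeasure lborel (?B i))"
      using emeasure_distr[OF homothety_measurable PA, of a s]
        lborel_vec.emeasure_PiM[of "{..<d}" ?B] B
      by (simp add: leb_d_def)
    then have "emeasure ?P (PiE {..<d} A) = ennreal (s ^ d) * (\<Prod>i<d. emeasure lborel (?B i))"
      using PA by (subst emeasure_density_const) auto
    also have "\<dots> = (\<Prod>i<d. ennreal s * emeasure lborel (?B i))"
      using assms by (simp add: prod.distrib ennreal_power)
    also have "\<dots> = (\<Prod>i<d. emeasure lborel (A i))" using 1 by (intro prod.cong) auto
    finally show "emeasure ?P (PiE {..<d} A) = (\<Prod>i<d. emeasure lborel (A i))" .
  qed (auto simp: leb_d_def)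
  then show ?thesis by (simp add: leb_d_def)
qed

lemma integral_homothety:
  assumes "s > 0" "G \<in> borel_measurable (leb_d d)"
  shows "(\<integral>x. G x \<partial>leb_d d) = s ^ d * (\<integral>x. G (homothety d a s x) \<partial>leb_d d)"
proof -
  let ?D = "distr (leb_d d) (leb_d d) (homothety d a s)"
  have "(\<integral>x. G x \<partial>leb_d d) = (\<integral>x. G x \<partial>density ?D (\<lambda>_. ennreal (s ^ d)))"
    using distr_homothety[OF assms(1)] by simp
  also have "\<dots> = (\<integral>x. s ^ d *\<^sub>R G x \<partial>?D)"
    using assms by (intro integral_density) auto
  also have "\<dots> = s ^ d * (\<integral>x. G x \<partial>?D)" by simp
  also have "(\<integral>x. G x \<partial>?D) = (\<integral>x. G (homothety d a s x) \<partial>leb_d d)"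
    using assms by (intro integral_distr homothety_measurable)
  finally show ?thesis .
qed

section \<open>Finite and positive volume of a body\<close>

lemma emeasure_box:
  "emeasure (leb_d d) (PiE {..<d} (\<lambda>i. {z i - e..z i + e})) = ennreal (2 * e) ^ d" if "e > 0"
proof -
  have "emeasure (leb_d d) (PiE {..<d} (\<lambda>i. {z i - e..z i + e}))
      = (\<Prod>i<d. emeasure lborel {z i - e..z i + e})"
    unfolding leb_d_def by (intro lborel_vec.emeasure_PiM) auto
  also have "\<dots> = (\<Prod>i<d. ennreal (2 * e))" using that by (intro prod.cong) auto
  finally show ?thesis by simp
qed

lemma box_sets: "PiE {..<d} (\<lambda>i. {z i - e..z i + e :: real}) \<in> sets (leb_d d)"
  unfolding leb_d_def by (intro sets_PiM_I_finite) auto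

lemma region_d_emeasure:
  assumes "convex_body d K"
  shows "emeasure (leb_d d) (region_d d K) < \<infinity>" "measure (leb_d d) (region_d d K) > 0"
proof -
  have K: "closed_d d K" "bounded_d d K" "K \<subseteq> Rd d" using assms by (auto simp: convex_body_def)
  obtain R where R: "R > 0" "\<And>x i. x \<in> K \<Longrightarrow> \<bar>x i\<bar> \<le> R" using bounded_dD K by metis
  have "x i \<in> {0 - R..0 + R}" if "ext0 d x \<in> K" "i < d" for x i
    using R(2)[OF that(1), of i] that(2) by (auto simp: ext0_def)
  then have "region_d d K \<subseteq> PiE {..<d} (\<lambda>i. {0 - R..0 + R})"
    unfolding region_d_def leb_d_def space_PiM by (simp add: subset_iff PiE_iff)
  then have "emeasure (leb_d d) (region_d d K)
      \<le> emeasure (leb_d d) (PiE {..<d} (\<lambda>i. {0 - R..0 + R}))"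
    by (rule emeasure_mono[OF _ box_sets])
  then have "emeasure (leb_d d) (region_d d K) \<le> ennreal (2 * R) ^ d"
    unfolding emeasure_box[OF R(1)] .
  then show fin: "emeasure (leb_d d) (region_d d K) < \<infinity>"
    by (rule le_less_trans) (simp add: R(1) less_imp_le ennreal_power)
  obtain z r where z: "z \<in> Rd d" "r > 0" "{y \<in> Rd d. enorm d (vsub y z) < r} \<subseteq> K"
    using assms by (auto simp: convex_body_def interior_d_def)
  \<comment> \<open>The estimate of the norm by d times the sup norm turns half-side r/(d + 1) into
    a norm below r, so the cube lies in the open ball.\<close>
  define e where "e = r / (d + 1)"
  have e: "e > 0" "real d * e < r" using z(2) by (auto simp: e_def field_simps)
  have "ext0 d x \<in> K" if "x \<in> PiE {..<d} (\<lambda>i. {z i - e..z i + e})" for x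
  proof -
    have "enorm d (vsub (ext0 d x) z) \<le> real d * e"
    proof (rule enorm_le_sup)
      fix i assume "i < d"
      then have "x i \<in> {z i - e..z i + e}" using PiE_mem[OF that, of i] by simp
      then show "\<bar>vsub (ext0 d x) z i\<bar> \<le> e" using \<open>i < d\<close> by (auto simp: vsub_def ext0_def)
    qed
    then show ?thesis using z(3) e(2) by (auto simp: ext0_def Rd_def)
  qed
  then have "PiE {..<d} (\<lambda>i. {z i - e..z i + e}) \<subseteq> region_d d K"
    by (auto simp: region_d_def leb_d_def space_PiM)
  then have "emeasure (leb_d d) (PiE {..<d} (\<lambda>i. {z i - e..z i + e}))
      \<le> emeasure (leb_d d) (region_d d K)"
    by (rule emeasure_mono[OF _ region_d_sets[OF assms]])
  then have "ennreal (2 * e) ^ d \<le> emeasure (leb_d d) (region_d d K)"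
    unfolding emeasure_box[OF e(1)] .
  moreover have "0 < ennreal (2 * e) ^ d" using e by (simp add: ennreal_power)
  ultimately have "0 < emeasure (leb_d d) (region_d d K)" by order
  then show "measure (leb_d d) (region_d d K) > 0"
    using fin by (simp add: measure_def enn2real_positive_iff)
qed

text \<open>Scaling \<open>K\<close> about \<open>x\<^sub>0\<close> by \<open>t\<close> multiplies the volume by \<open>t ^ d\<close> and the integral of a linear
  form by \<open>t ^ (d + 1)\<close>. Bounding the form by its maximum \<open>b\<close> on the removed shell and letting
  \<open>t\<close> tend to \<open>1\<close> gives mean value at most \<open>b * d / (d + 1)\<close>.\<close>
lemma centroid_linear_bound:
  assumes K: "convex_body d K" and x0: "x0 \<in> K"
    and b: "\<And>x. x \<in> K \<Longrightarrow> (\<Sum>i<d. a i * (x i - x0 i)) \<le> b"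
  shows "(real d + 1) * (\<Sum>i<d. a i * (centroid d K i - x0 i)) \<le> real d * b"
proof -
  define M where "M = leb_d d"
  define S where "S = region_d d K"
  define V where "V = measure M S"
  define F where "F x = (\<Sum>i<d. a i * (x i - x0 i))" for x :: vec
  define I where "I = (\<integral>x. indicator S x * F x \<partial>M)"
  have S: "S \<in> sets M" and Sfin: "emeasure M S < \<infinity>" and V: "V > 0"
    using region_d_sets[OF K] region_d_emeasure[OF K] by (auto simp: S_def M_def V_def)
  have coord[measurable]: "(\<lambda>x. x i) \<in> borel_measurable M" if "i < d" for i
    unfolding M_def using that by (rule coord_measurable)
  have F_meas[measurable]: "F \<in> borel_measurable M"
    unfolding F_def by (intro borel_measurable_sum borel_measurable_times borel_measurable_diff coord) auto
  have conv: "convex_set K" and sub: "K \<subseteq> Rd d" using K by (auto simp: convex_body_def)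
  obtain R where R: "R > 0" "\<And>x i. x \<in> K \<Longrightarrow> \<bar>x i\<bar> \<le> R"
    using bounded_dD K by (metis convex_body_def)
  have SK: "x \<in> S \<longleftrightarrow> x \<in> space M \<and> ext0 d x \<in> K" for x by (auto simp: S_def M_def region_d_def)
  have int_coord: "integrable M (\<lambda>x. indicator S x * x i)" if "i < d" for i
  proof -
    have "AE x in M. x \<in> S \<longrightarrow> norm (x i) \<le> R"
      using R(2)[of "ext0 d _" i] that by (auto simp: SK ext0_def)
    from integrableI_bounded_set_indicator[OF S coord[OF that] Sfin this] show ?thesis by simp
  qed
  have int_S: "integrable M (indicator S :: _ \<Rightarrow> real)" using S Sfin by simp
  have int_F: "integrable M (\<lambda>x. indicator S x * F x)"
  proof -
    have "(\<lambda>x. indicator S x * F x)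
        = (\<lambda>x. \<Sum>i<d. a i * (indicator S x * x i) - a i * x0 i * indicator S x)"
      by (auto simp: F_def sum_distrib_left algebra_simps)
    then show ?thesis
      using int_coord int_S
      by (auto intro!: Bochner_Integration.integrable_sum Bochner_Integration.integrable_diff)
  qed
  have I_eq: "I = V * F (centroid d K)"
  proof -
    have "I = (\<integral>x. (\<Sum>i<d. a i * (indicator S x * x i) - a i * x0 i * indicator S x) \<partial>M)"
      unfolding I_def by (intro Bochner_Integration.integral_cong) (auto simp: F_def sum_distrib_left algebra_simps)
    also have "\<dots> = (\<Sum>i<d. a i * (\<integral>x. indicator S x * x i \<partial>M) - a i * x0 i * V)"
      using int_coord int_S S
      by (subst Bochner_Integration.integral_sum) (auto simp: V_def)
    also have "\<dots> = V * F (centroid d K)"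
      using V unfolding F_def sum_distrib_left
      by (intro sum.cong) (auto simp: centroid_def S_def M_def V_def field_simps)
    finally show ?thesis .
  qed
  have bound: "(1 - t ^ (d + 1)) * I \<le> (1 - t ^ d) * V * b" if t: "0 < t" "t < 1" for t
  proof -
    let ?h = "homothety d x0 (1 / t)"
    have h: "?h \<in> measurable M M" unfolding M_def by (rule homothety_measurable)
    have Fh: "F (?h x) = F x / t" for x
      using t by (auto simp: F_def homothety_def sum_divide_distrib intro!: sum.cong)
    \<comment> \<open>Since x = (1 - t) x0 + t h(x), convexity puts the shrunken copy of S inside S;
      the difference of the two indicators is then the indicator of the shell.\<close>
    have hS: "x \<in> S" if x: "x \<in> space M" "?h x \<in> S" for x
    proof -
      have "ext0 d (?h x) \<in> K" using x by (simp add: SK)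
      from convex_setD[OF conv x0 this, of t] t
      have "(\<lambda>i. (1 - t) * x0 i + t * ext0 d (?h x) i) \<in> K" by simp
      also have "(\<lambda>i. (1 - t) * x0 i + t * ext0 d (?h x) i) = ext0 d x"
        using t x0 sub by (auto simp: ext0_def homothety_def Rd_def fun_eq_iff field_simps)
      finally show ?thesis using x by (simp add: SK)
    qed
    have F_le: "F x \<le> b" if "x \<in> S" for x
    proof -
      have "F x = F (ext0 d x)" by (simp add: F_def ext0_def)
      then show ?thesis using b[of "ext0 d x"] that by (simp add: SK F_def)
    qed
    have int_hS: "integrable M (\<lambda>x. indicator S (?h x) :: real)"
      by (rule Bochner_Integration.integrable_bound[OF int_S])
         (use hS h S in \<open>auto simp: indicator_def intro!: AE_I2 measurable_compose[OF h]\<close>)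
    have int_hF: "integrable M (\<lambda>x. indicator S (?h x) * F x)"
      by (rule Bochner_Integration.integrable_bound[OF int_F])
         (use hS h S in \<open>auto simp: indicator_def intro!: AE_I2 borel_measurable_times measurable_compose[OF h]\<close>)
    have V_eq: "V = (1 / t) ^ d * (\<integral>x. indicator S (?h x) \<partial>M)"
      using integral_homothety[of "1 / t" "indicator S" d x0] t S by (simp add: V_def M_def)
    have "I = (1 / t) ^ d * (\<integral>x. indicator S (?h x) * F (?h x) \<partial>M)"
      unfolding I_def M_def
      by (rule integral_homothety) (use t S F_meas in \<open>auto simp: M_def\<close>)
    also have "\<dots> = (1 / t) ^ (d + 1) * (\<integral>x. indicator S (?h x) * F x \<partial>M)"
      by (simp add: Fh)
    finally have I_eq': "I = (1 / t) ^ (d + 1) * (\<integral>x. indicator S (?h x) * F x \<partial>M)" .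
    have "(\<integral>x. indicator S x * F x - indicator S (?h x) * F x \<partial>M)
        \<le> (\<integral>x. b * (indicator S x - indicator S (?h x)) \<partial>M)"
    proof (rule integral_mono)
      show "integrable M (\<lambda>x. b * (indicator S x - indicator S (?h x)))"
        using int_S int_hS by (intro integrable_mult_right Bochner_Integration.integrable_diff)
      show "indicator S x * F x - indicator S (?h x) * F x \<le> b * (indicator S x - indicator S (?h x))"
        if "x \<in> space M" for x
        using F_le hS that by (auto simp: indicator_def)
    qed (use int_F int_hF in simp)
    then have "I - (\<integral>x. indicator S (?h x) * F x \<partial>M) \<le> b * (V - (\<integral>x. indicator S (?h x) \<partial>M))"
      using int_S int_hS int_F int_hF S by (simp add: I_def V_def)
    moreover have "(\<integral>x. indicator S (?h x) * F x \<partial>M) = t ^ (d + 1) * I"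
      using t by (subst I_eq') (simp add: power_divide field_simps)
    moreover have "(\<integral>x. indicator S (?h x) \<partial>M) = t ^ d * V"
      using t by (subst V_eq) (simp add: power_divide field_simps)
    ultimately show ?thesis by (simp add: algebra_simps)
  qed
  \<comment> \<open>Both factors 1 - t^(d + 1) and 1 - t^d vanish at t = 1; cancelling 1 - t leaves
    geometric sums, with values d + 1 and d at 1.\<close>
  have poly: "(\<Sum>k<d + 1. t ^ k) * F (centroid d K) \<le> (\<Sum>k<d. t ^ k) * b" if t: "0 < t" "t < 1" for t
  proof -
    have "V * ((1 - t ^ (d + 1)) * F (centroid d K)) \<le> V * ((1 - t ^ d) * b)"
      using bound[OF t] by (simp add: I_eq algebra_simps)
    then have "(1 - t ^ (d + 1)) * F (centroid d K) \<le> (1 - t ^ d) * b"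
      using V by simp
    then have "(1 - t) * ((\<Sum>k<d + 1. t ^ k) * F (centroid d K)) \<le> (1 - t) * ((\<Sum>k<d. t ^ k) * b)"
      unfolding one_diff_power_eq mult.assoc .
    then show ?thesis using t by simp
  qed
  have "(\<Sum>k<d + 1. 1 ^ k) * F (centroid d K) \<le> (\<Sum>k<d. 1 ^ k) * b"
  proof (rule tendsto_le)
    show "((\<lambda>t. (\<Sum>k<d. t ^ k) * b) \<longlongrightarrow> (\<Sum>k<d. 1 ^ k) * b) (at_left (1::real))"
      by (intro tendsto_intros)
    show "((\<lambda>t. (\<Sum>k<d + 1. t ^ k) * F (centroid d K)) \<longlongrightarrow> (\<Sum>k<d + 1. 1 ^ k) * F (centroid d K))
        (at_left (1::real))"
      by (intro tendsto_intros)
    have "eventually (\<lambda>t::real. 0 < t \<and> t < 1) (at_left 1)"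
      unfolding eventually_at_left_field by (intro exI[of _ 0]) auto
    then show "eventually (\<lambda>t. (\<Sum>k<d + 1. t ^ k) * F (centroid d K) \<le> (\<Sum>k<d. t ^ k) * b)
        (at_left (1::real))"
      by eventually_elim (use poly in auto)
  qed simp
  then show ?thesis by (simp add: F_def add.commute)
qed

text \<open>Minkowski's inequality: -(K - c) is contained in d (K - c). Measured from x0, a
  functional separating the point from K takes at c the value d/(d + 1) times its value at the
  point, which exceeds d/(d + 1) times its upper bound on K and contradicts
  \<open>centroid_linear_bound\<close>.\<close>

lemma centroid_reflection:
  assumes K: "convex_body d K" and x0: "x0 \<in> K" and d: "d > 0"
  shows "(\<lambda>i. centroid d K i + (centroid d K i - x0 i) / real d) \<in> K" (is "?z \<in> K")
proof (rule ccontr)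
  assume notin: "?z \<notin> K"
  have "?z \<in> Rd d"
    using K x0 by (auto simp: Rd_def centroid_def convex_body_def subset_iff)
  from separation[OF K this notin] obtain a b
    where a: "\<And>x. x \<in> K \<Longrightarrow> (\<Sum>i<d. a i * x i) \<le> b" "b < (\<Sum>i<d. a i * ?z i)"
    by blast
  let ?f = "\<Sum>i<d. a i * x0 i"
  have "(\<Sum>i<d. a i * (x i - x0 i)) \<le> b - ?f" if "x \<in> K" for x
    using a(1)[OF that] by (simp add: right_diff_distrib sum_subtractf)
  then have "(real d + 1) * (\<Sum>i<d. a i * (centroid d K i - x0 i)) \<le> real d * (b - ?f)"
    by (rule centroid_linear_bound[OF K x0])
  moreover have "real d * (\<Sum>i<d. a i * ?z i)
      = (real d + 1) * (\<Sum>i<d. a i * (centroid d K i - x0 i)) + real d * ?f"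
  proof -
    have "(\<Sum>i<d. real d * (a i * ?z i)) = (\<Sum>i<d. (real d + 1) * (a i * (centroid d K i - x0 i)) + real d * (a i * x0 i))"
      using d by (intro sum.cong refl) (simp add: field_simps)
    then show ?thesis by (simp add: sum_distrib_left sum.distrib)
  qed
  moreover have "real d * b < real d * (\<Sum>i<d. a i * ?z i)" using a(2) d by simp
  ultimately show False by (simp add: algebra_simps)
qed

subsection \<open>Gauges and the number \<open>P\<close>\<close>

lemma gauge_le:
  assumes "\<mu> > 0" "x \<in> set_scale \<mu> L"
  shows "gauge L x \<le> \<mu>"
  unfolding gauge_def using assms by (intro cInf_lower) (auto intro: bdd_belowI[of _ 0])

text \<open>The witness keeps the set under \<open>Inf\<close> nonempty; the infimum of the empty
  set of reals is unspecified.\<close>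

lemma gauge_ge:
  assumes "\<mu> > 0" "x \<in> set_scale \<mu> L" "\<And>\<mu>. \<mu> > 0 \<Longrightarrow> x \<in> set_scale \<mu> L \<Longrightarrow> s \<le> \<mu>"
  shows "s \<le> gauge L x"
  unfolding gauge_def using assms by (intro cInf_greatest) auto

lemma gauge_zero:
  assumes "(\<lambda>i. 0) \<in> L"
  shows "gauge L (\<lambda>i. 0) \<le> 0"
proof (rule field_le_epsilon)
  fix e :: real assume "e > 0"
  then show "gauge L (\<lambda>i. 0) \<le> 0 + e"
    using gauge_le[of e "\<lambda>i. 0" L] assms by (simp add: set_scale_iff)
qed

lemma sym_core_iff: "x \<in> sym_core K \<longleftrightarrow> x \<in> K \<and> (\<lambda>i. - x i) \<in> K"
proof -
  have "x \<in> vscale (-1) ` K \<longleftrightarrow> (\<lambda>i. - x i) \<in> K"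
  proof
    assume "(\<lambda>i. - x i) \<in> K"
    moreover have "x = vscale (-1) (\<lambda>i. - x i)" by (simp add: vscale_def)
    ultimately show "x \<in> vscale (-1) ` K" by blast
  qed (auto simp: vscale_def)
  then show ?thesis by (simp add: sym_core_def)
qed

lemma half_diffI: "a \<in> K \<Longrightarrow> b \<in> K \<Longrightarrow> (\<lambda>i. (a i - b i) / 2) \<in> half_diff K"
  by (force simp: half_diff_def vscale_def vsub_def)

text \<open>Quantitative form of a body around the origin. The quotient R/r later bounds the size of
  every configuration counted by \<open>P_num\<close>.\<close>

locale origin_body =
  fixes d :: nat and Q :: "vec set" and r R :: real
  assumes convex: "convex_set Q"
    and sub_Rd: "Q \<subseteq> Rd d"
    and r_pos: "r > 0" and ball: "\<And>x. x \<in> Rd d \<Longrightarrow> enorm d x < r \<Longrightarrow> x \<in> Q"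
    and R_pos: "R > 0" and bounded: "\<And>x i. x \<in> Q \<Longrightarrow> \<bar>x i\<bar> \<le> R"
begin

lemma zero_mem: "(\<lambda>i. 0) \<in> Q"
  using r_pos by (intro ball) (auto simp: Rd_def enorm_def)

lemma shrink_mem: "x \<in> Q \<Longrightarrow> 0 \<le> t \<Longrightarrow> t \<le> 1 \<Longrightarrow> (\<lambda>i. t * x i) \<in> Q"
  using convex_setD[OF convex zero_mem] by auto

text \<open>A convex combination with weights proportional to a and b, followed by a contraction
  towards the origin by (a + b)/c.\<close>

lemma conic_mem:
  assumes "x \<in> Q" "y \<in> Q" "0 \<le> a" "0 \<le> b" "a + b \<le> c" "c > 0"
  shows "(\<lambda>i. (a * x i + b * y i) / c) \<in> Q"
proof (cases "a + b = 0")
  case True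
  then have "a = 0" "b = 0" using assms by auto
  then show ?thesis using zero_mem by simp
next
  case False
  then have ab: "a + b > 0" using assms by auto
  define t where "t = b / (a + b)"
  have t: "0 \<le> t" "t \<le> 1" "(a + b) * (1 - t) = a" "(a + b) * t = b"
    using assms ab by (auto simp: t_def field_simps)
  have mem: "(\<lambda>i. (a + b) / c * ((1 - t) * x i + t * y i)) \<in> Q"
    using assms t by (intro shrink_mem convex_setD[OF convex]) auto
  have eq: "(a + b) / c * ((1 - t) * x i + t * y i) = (a * x i + b * y i) / c" for i
  proof -
    have "(a + b) * ((1 - t) * x i + t * y i) = a * x i + b * y i"
      by (simp only: distrib_left mult.assoc[symmetric] t)
    then show ?thesis by simp
  qed
  show ?thesis using mem by (simp only: eq)
qed

lemma zero_mem_sym_core: "(\<lambda>i. 0) \<in> sym_core Q"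
  using zero_mem by (simp add: sym_core_iff)

text \<open>After division by the factor, x has norm at most d r/(d + 1) < r, so it and its negative
  lie in the inner ball. This also provides the witnesses that keep the gauges from being infima of
  empty sets.\<close>

lemma sym_core_scale:
  assumes "x \<in> Rd d" "s > 0" "\<And>i. i < d \<Longrightarrow> \<bar>x i\<bar> \<le> s"
  shows "x \<in> set_scale ((real d + 1) / r * s) (sym_core Q)"
proof -
  let ?c = "(real d + 1) / r * s"
  have c: "?c > 0" using assms r_pos by simp
  have "(\<lambda>i. \<epsilon> * (x i / ?c)) \<in> Q" if "\<epsilon> = 1 \<or> \<epsilon> = -1" for \<epsilon> :: real
  proof (rule ball)
    show "(\<lambda>i. \<epsilon> * (x i / ?c)) \<in> Rd d" using assms(1) by (auto simp: Rd_def)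
    have "\<bar>x i\<bar> / ?c \<le> r / (real d + 1)" if "i < d" for i
    proof -
      have "\<bar>x i\<bar> / ?c \<le> s / ?c" using assms(3)[OF that] c by (intro divide_right_mono) auto
      then show ?thesis using assms(2) r_pos by simp
    qed
    then have "enorm d (\<lambda>i. \<epsilon> * (x i / ?c)) \<le> real d * (r / (real d + 1))"
      using that assms(2) r_pos by (intro enorm_le_sup) (auto simp: abs_mult)
    also have "\<dots> < r" using r_pos by (simp add: field_simps)
    finally show "enorm d (\<lambda>i. \<epsilon> * (x i / ?c)) < r" .
  qed
  from this[of 1] this[of "-1"] show ?thesis
    unfolding set_scale_iff[OF c] sym_core_iff by simp
qed

lemma Rd_le_sup: "x \<in> Rd d \<Longrightarrow> \<exists>s>0. \<forall>i<d. \<bar>x i\<bar> \<le> s"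
  using member_le_sum[of _ "{..<d}" "\<lambda>i. \<bar>x i\<bar>"]
  by (intro exI[of _ "(\<Sum>i<d. \<bar>x i\<bar>) + 1"]) (auto simp: sum_nonneg add_nonneg_pos intro: add_increasing2)

lemma gauge_sym_core_ge:
  assumes "x \<in> Rd d" "\<And>\<mu>. \<mu> > 0 \<Longrightarrow> (\<lambda>i. x i / \<mu>) \<in> Q \<Longrightarrow> (\<lambda>i. - x i / \<mu>) \<in> Q \<Longrightarrow> s \<le> \<mu>"
  shows "s \<le> gauge (sym_core Q) x"
proof -
  obtain u where u: "u > 0" "\<And>i. i < d \<Longrightarrow> \<bar>x i\<bar> \<le> u" using Rd_le_sup[OF assms(1)] by blast
  show ?thesis
  proof (rule gauge_ge)
    show "x \<in> set_scale ((real d + 1) / r * u) (sym_core Q)" by (rule sym_core_scale) (use assms u in auto)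
    show "(real d + 1) / r * u > 0" using u r_pos by simp
  next
    fix \<mu> :: real assume "\<mu> > 0" "x \<in> set_scale \<mu> (sym_core Q)"
    then show "s \<le> \<mu>" using assms(2)[of \<mu>] by (simp add: set_scale_iff sym_core_iff)
  qed
qed

text \<open>\<open>half_diff Q\<close> lies in the cube with coordinates in [-R, R]. The opposite
  points x/c and -x/c of Q show that some multiple of it contains x.\<close>

lemma abs_coord_le_gauge_half_diff:
  assumes "x \<in> Rd d"
  shows "\<bar>x i\<bar> / R \<le> gauge (half_diff Q) x"
proof -
  obtain u where u: "u > 0" "\<And>i. i < d \<Longrightarrow> \<bar>x i\<bar> \<le> u" using Rd_le_sup[OF assms] by blast
  define c where "c = (real d + 1) / r * u"
  have c: "c > 0" using u r_pos by (simp add: c_def)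
  have "x \<in> set_scale c (sym_core Q)" unfolding c_def by (rule sym_core_scale) (use assms u in auto)
  then have "(\<lambda>i. x i / c) \<in> Q" "(\<lambda>i. - (x i / c)) \<in> Q"
    using c by (auto simp: set_scale_iff sym_core_iff)
  from half_diffI[OF this] have "x \<in> set_scale c (half_diff Q)"
    using c by (simp add: set_scale_iff)
  with c show ?thesis
  proof (rule gauge_ge)
    fix \<mu> :: real assume "\<mu> > 0" "x \<in> set_scale \<mu> (half_diff Q)"
    then obtain a b where ab: "a \<in> Q" "b \<in> Q" "(\<lambda>i. x i / \<mu>) = (\<lambda>i. (a i - b i) / 2)"
      by (auto simp: set_scale_iff half_diff_def vscale_def vsub_def)
    have "\<bar>(a i - b i) / 2\<bar> \<le> R" 
      using bounded[OF ab(1), of i] bounded[OF ab(2), of i] abs_triangle_ineq4[of "a i" "b i"] by simp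
    then have "\<bar>x i / \<mu>\<bar> \<le> R" unfolding fun_cong[OF ab(3), of i] .
    then show "\<bar>x i\<bar> / R \<le> \<mu>" using \<open>\<mu> > 0\<close> R_pos by (simp add: field_simps)
  qed
qed

text \<open>Rescaling by the least sup-distance and rounding to half-integers separates the points.\<close>
lemma P_config_bounded:
  assumes inj: "inj_on p {..<m}" and p: "\<And>i. i < m \<Longrightarrow> p i \<in> Rd d"
    and ratio: "\<And>i j k l. i < m \<Longrightarrow> j < m \<Longrightarrow> k < m \<Longrightarrow> l < m \<Longrightarrow> i \<noteq> j \<Longrightarrow> k \<noteq> l \<Longrightarrow>
      gauge (half_diff Q) (vsub (p i) (p j)) \<le> \<Lambda> * gauge (sym_core Q) (vsub (p k) (p l))"
    and \<Lambda>: "\<Lambda> \<ge> 0"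
  shows "m \<le> nat (2 * \<lceil>2 * (R * \<Lambda> * (real d + 1) / r)\<rceil> + 3) ^ d + 1"
proof (cases "m \<le> 1")
  case False
  define N where "N x = (MAX i\<in>{..<d}. \<bar>x i\<bar>)" for x :: vec
  define A where "A = {(k, l). k < m \<and> l < m \<and> k \<noteq> l}"
  have "A \<subseteq> {..<m} \<times> {..<m}" by (auto simp: A_def)
  then have finA: "finite A" by (rule finite_subset) simp
  have "(0, 1) \<in> A" using False by (auto simp: A_def)
  then have A: "A \<noteq> {}" by blast
  have d: "d > 0"
  proof (rule ccontr)
    assume "\<not> d > 0"
    then have "p 0 = p 1" using p[of 0] p[of 1] False by (auto simp: Rd_def fun_eq_iff)
    then show False using inj False by (auto dest: inj_onD)
  qed
  have N_ge: "\<bar>x i\<bar> \<le> N x" if "i < d" for x i unfolding N_def using that by (intro Max_ge) auto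
  have N_attained: "\<exists>i<d. N x = \<bar>x i\<bar>" for x
  proof -
    have "N x \<in> (\<lambda>i. \<bar>x i\<bar>) ` {..<d}" unfolding N_def using d by (intro Max_in) auto
    then show ?thesis by auto
  qed
  define \<delta> where "\<delta> = (MIN (k, l)\<in>A. N (vsub (p k) (p l)))"
  have "\<delta> \<in> (\<lambda>(k, l). N (vsub (p k) (p l))) ` A"
    unfolding \<delta>_def using A finA by (intro Min_in) auto
  then obtain k l where kl: "(k, l) \<in> A" "\<delta> = N (vsub (p k) (p l))" by auto
  have \<delta>_le: "\<delta> \<le> N (vsub (p i) (p j))" if "i < m" "j < m" "i \<noteq> j" for i j
    unfolding \<delta>_def using that finA by (intro Min_le) (force simp: A_def)+
  have diff_Rd: "vsub (p i) (p j) \<in> Rd d" if "i < m" "j < m" for i j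
    using p[OF that(1)] p[OF that(2)] by (auto simp: Rd_def vsub_def)
  have \<delta>: "\<delta> > 0"
  proof (rule ccontr)
    assume "\<not> \<delta> > 0"
    then have "p k c = p l c" for c
      using N_ge[of c "vsub (p k) (p l)"] kl p[of k] p[of l]
      by (cases "c < d") (auto simp: A_def Rd_def vsub_def)
    then have "p k = p l" by blast
    then show False using kl(1) inj by (auto simp: A_def dest: inj_onD)
  qed
  define L where "L = R * \<Lambda> * (real d + 1) / r"
  have L: "L \<ge> 0" using R_pos \<Lambda> r_pos by (simp add: L_def)
  \<comment> \<open>Everything is compared with the closest pair (k, l): a coordinate is at most R
    times the half-difference gauge, that gauge at most \<Lambda> times the core gauge of the
    closest pair, and the latter at most (d + 1)/r times \<delta>.\<close>
  have far: "\<bar>p i c - p j c\<bar> \<le> L * \<delta>" if "i < m" "j < m" for i j c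
  proof (cases "i = j")
    case True
    then show ?thesis using L \<delta> by simp
  next
    case False
    have kl': "k < m" "l < m" "k \<noteq> l" using kl(1) by (auto simp: A_def)
    have "\<bar>vsub (p i) (p j) c\<bar> / R \<le> gauge (half_diff Q) (vsub (p i) (p j))"
      by (rule abs_coord_le_gauge_half_diff) (rule diff_Rd[OF that])
    also have "\<dots> \<le> \<Lambda> * gauge (sym_core Q) (vsub (p k) (p l))"
      by (rule ratio) (use that kl' False in auto)
    also have "gauge (sym_core Q) (vsub (p k) (p l)) \<le> (real d + 1) / r * \<delta>"
      using N_ge[of _ "vsub (p k) (p l)"] kl(2) \<delta> r_pos diff_Rd[OF kl'(1,2)]
      by (intro gauge_le sym_core_scale) auto
    finally have "\<bar>vsub (p i) (p j) c\<bar> / R \<le> \<Lambda> * ((real d + 1) / r * \<delta>)"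
      using \<Lambda> by (simp add: mult_left_mono)
    then show ?thesis using R_pos by (simp add: L_def vsub_def field_simps)
  qed
  define M where "M = \<lceil>2 * L\<rceil> + 1"
  have M: "M \<ge> 1" using L by (simp add: M_def)
  define h where "h i = (\<lambda>c\<in>{..<d}. \<lfloor>2 * (p i c - p 0 c) / \<delta>\<rfloor>)" for i
  have "inj_on h {..<m}"
  proof (rule inj_onI, rule ccontr)
    fix i j assume ij: "i \<in> {..<m}" "j \<in> {..<m}" "h i = h j" "i \<noteq> j"
    obtain c where c: "c < d" "N (vsub (p i) (p j)) = \<bar>p i c - p j c\<bar>"
      using N_attained[of "vsub (p i) (p j)"] by (auto simp: vsub_def)
    have "\<lfloor>2 * (p i c - p 0 c) / \<delta>\<rfloor> = \<lfloor>2 * (p j c - p 0 c) / \<delta>\<rfloor>"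
      using fun_cong[OF ij(3), of c] c by (simp add: h_def)
    then have "\<bar>2 * (p i c - p 0 c) / \<delta> - 2 * (p j c - p 0 c) / \<delta>\<bar> < 1" by linarith
    also have "2 * (p i c - p 0 c) / \<delta> - 2 * (p j c - p 0 c) / \<delta> = 2 * (p i c - p j c) / \<delta>"
      using \<delta> by (simp add: field_simps)
    finally have "2 * \<bar>p i c - p j c\<bar> < \<delta>"
      using \<delta> by (simp only: abs_mult abs_divide) (simp add: divide_less_eq)
    then show False using \<delta>_le[of i j] ij c \<delta> by auto
  qed
  moreover have "h ` {..<m} \<subseteq> PiE {..<d} (\<lambda>_. {- M..M})"
  proof
    fix y assume "y \<in> h ` {..<m}"
    then obtain i where i: "i < m" "y = h i" by auto
    have "\<lfloor>2 * (p i c - p 0 c) / \<delta>\<rfloor> \<in> {- M..M}" for c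
    proof -
      have "\<bar>p i c - p 0 c\<bar> \<le> L * \<delta>" using far i False by simp
      then have "\<bar>2 * (p i c - p 0 c) / \<delta>\<bar> \<le> 2 * L" using \<delta> by (simp add: abs_mult field_simps)
      then show ?thesis unfolding M_def atLeastAtMost_iff by linarith
    qed
    then show "y \<in> PiE {..<d} (\<lambda>_. {- M..M})" unfolding i(2) h_def by (intro restrict_PiE_iff[THEN iffD2]) blast
  qed
  ultimately have "card {..<m} \<le> card (PiE {..<d} (\<lambda>_. {- M..M}))"
    by (intro card_inj_on_le) (auto intro: finite_PiE)
  also have "\<dots> = nat (2 * M + 1) ^ d" using M by (simp add: card_PiE)
  finally show ?thesis by (simp add: M_def L_def algebra_simps)
qed simp

text \<open>A common scale s replaces the quotient of maximum by minimum. Distances of at least s >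
  0 force f to be injective, and \<open>P_config_bounded\<close> makes the \<open>Sup\<close> in
  \<open>P_num\<close> an upper bound.\<close>

lemma card_le_P_num:
  assumes S: "finite S" and f: "\<And>i. i \<in> S \<Longrightarrow> f i \<in> Rd d" and s: "s > 0" and \<Lambda>: "\<Lambda> \<ge> 0"
    and upper: "\<And>i j. i \<in> S \<Longrightarrow> j \<in> S \<Longrightarrow> i \<noteq> j \<Longrightarrow> gauge (half_diff Q) (vsub (f i) (f j)) \<le> \<Lambda> * s"
    and lower: "\<And>i j. i \<in> S \<Longrightarrow> j \<in> S \<Longrightarrow> i \<noteq> j \<Longrightarrow> s \<le> gauge (sym_core Q) (vsub (f i) (f j))"
  shows "card S \<le> P_num d Q \<Lambda>"
proof -
  obtain e where e: "bij_betw e {..<card S} S"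
    using ex_bij_betw_nat_finite[OF S] by (auto simp: atLeast0LessThan)
  have eS: "e i \<in> S" if "i < card S" for i using bij_betwE[OF e] that by auto
  have e_inj: "e i \<noteq> e j" if "i < card S" "j < card S" "i \<noteq> j" for i j
    using bij_betw_imp_inj_on[OF e] that by (auto dest: inj_onD)
  have "inj_on f S"
  proof (rule inj_onI, rule ccontr)
    fix i j assume "i \<in> S" "j \<in> S" "f i = f j" "i \<noteq> j"
    then have "s \<le> gauge (sym_core Q) (\<lambda>i. 0)" using lower[of i j] by (simp add: vsub_def)
    then show False using gauge_zero[OF zero_mem_sym_core] s by simp
  qed
  then have "inj_on (f \<circ> e) {..<card S}"
    using e by (auto simp: bij_betw_def intro!: comp_inj_on)
  moreover have "gauge (half_diff Q) (vsub ((f \<circ> e) i) ((f \<circ> e) j))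
      \<le> \<Lambda> * gauge (sym_core Q) (vsub ((f \<circ> e) k) ((f \<circ> e) l))"
    if "i < card S" "j < card S" "k < card S" "l < card S" "i \<noteq> j" "k \<noteq> l" for i j k l
  proof -
    have "gauge (half_diff Q) (vsub (f (e i)) (f (e j))) \<le> \<Lambda> * s"
      using that eS e_inj by (intro upper) auto
    also have "\<dots> \<le> \<Lambda> * gauge (sym_core Q) (vsub (f (e k)) (f (e l)))"
      using that eS e_inj \<Lambda> by (intro mult_left_mono lower) auto
    finally show ?thesis by simp
  qed
  ultimately show ?thesis
    unfolding P_num_def
  proof (intro cSup_upper)
    show "bdd_above {m. \<exists>p :: nat \<Rightarrow> vec. inj_on p {..<m} \<and> (\<forall>i<m. p i \<in> Rd d) \<and>
     (\<forall>i<m. \<forall>j<m. \<forall>k<m. \<forall>l<m. i \<noteq> j \<and> k \<noteq> l \<longrightarrow>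
        gauge (half_diff Q) (vsub (p i) (p j)) \<le> \<Lambda> * gauge (sym_core Q) (vsub (p k) (p l)))}"
    proof (rule bdd_aboveI, safe)
      fix m and p :: "nat \<Rightarrow> vec"
      assume "inj_on p {..<m}" "\<forall>i<m. p i \<in> Rd d"
        "\<forall>i<m. \<forall>j<m. \<forall>k<m. \<forall>l<m. i \<noteq> j \<and> k \<noteq> l \<longrightarrow>
          gauge (half_diff Q) (vsub (p i) (p j)) \<le> \<Lambda> * gauge (sym_core Q) (vsub (p k) (p l))"
      then show "m \<le> nat (2 * \<lceil>2 * (R * \<Lambda> * (real d + 1) / r)\<rceil> + 3) ^ d + 1"
        using \<Lambda> by (intro P_config_bounded[of p]) auto
    qed
  qed (use eS f in \<open>auto intro!: exI[of _ "f \<circ> e"]\<close>)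
qed

subsection \<open>Counting the homothets\<close>

text \<open>An arrangement about the origin: \<open>touching\<close> writes a common point as w i +
  lam i a = w j + lam j b, and \<open>separated\<close> replaces the interior of lam j Q by the
  multiples \<mu> Q with \<mu> < lam j.\<close>

context
  fixes m :: nat and w :: "nat \<Rightarrow> vec" and lam :: "nat \<Rightarrow> real"
  assumes lam_pos: "\<And>i. i < m \<Longrightarrow> lam i > 0"
    and w_Rd: "\<And>i. i < m \<Longrightarrow> w i \<in> Rd d"
    and separated: "\<And>i j \<mu>. i < m \<Longrightarrow> j < m \<Longrightarrow> i \<noteq> j \<Longrightarrow> 0 < \<mu> \<Longrightarrow> \<mu> < lam j \<Longrightarrow>
        (\<lambda>c. (w i c - w j c) / \<mu>) \<notin> Q"
    and touching: "\<And>i j. i < m \<Longrightarrow> j < m \<Longrightarrow>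
        \<exists>a\<in>Q. \<exists>b\<in>Q. \<forall>c. w i c - w j c = lam j * b c - lam i * a c"
begin

text \<open>Since lam \<le> q s, dividing both terms of \<open>touching\<close> by q s leaves points
  of Q, whose half difference gives 2 q s. The lower bound uses \<open>separated\<close> in one
  orientation, as the core lies in Q.\<close>

lemma similar_sizes_card:
  assumes S: "S \<subseteq> {..<m}" and s: "s > 0" and q: "q \<ge> 1"
    and size: "\<And>i. i \<in> S \<Longrightarrow> s \<le> lam i \<and> lam i \<le> q * s"
  shows "card S \<le> P_num d Q (2 * q)"
proof (rule card_le_P_num)
  show "finite S" using S finite_subset by blast
  show "w i \<in> Rd d" if "i \<in> S" for i using w_Rd S that by auto
  fix i j assume ij: "i \<in> S" "j \<in> S" "i \<noteq> j"
  then have ijm: "i < m" "j < m" using S by auto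
  show "gauge (half_diff Q) (vsub (w i) (w j)) \<le> 2 * q * s"
  proof (rule gauge_le)
    obtain a b where ab: "a \<in> Q" "b \<in> Q" "\<And>c. w i c - w j c = lam j * b c - lam i * a c"
      using touching[OF ijm] by blast
    have "(\<lambda>c. lam k / (q * s) * x c) \<in> Q" if "k \<in> S" "x \<in> Q" for k x
      using size[OF that(1)] s q by (intro shrink_mem[OF that(2)]) auto
    then have "(\<lambda>c. lam j / (q * s) * b c) \<in> Q" "(\<lambda>c. lam i / (q * s) * a c) \<in> Q"
      using ab ij by auto
    from half_diffI[OF this]
    have "(\<lambda>c. (lam j / (q * s) * b c - lam i / (q * s) * a c) / 2) \<in> half_diff Q" .
    also have "(\<lambda>c. (lam j / (q * s) * b c - lam i / (q * s) * a c) / 2)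
        = (\<lambda>c. vsub (w i) (w j) c / (2 * q * s))"
      using s q by (auto simp: vsub_def ab(3) field_simps)
    finally show "vsub (w i) (w j) \<in> set_scale (2 * q * s) (half_diff Q)"
      using s q by (subst set_scale_iff) auto
    show "2 * q * s > 0" using s q by simp
  qed
  show "s \<le> gauge (sym_core Q) (vsub (w i) (w j))"
  proof (rule gauge_sym_core_ge)
    show "vsub (w i) (w j) \<in> Rd d" using w_Rd[OF ijm(1)] w_Rd[OF ijm(2)] by (auto simp: Rd_def vsub_def)
    fix \<mu> :: real assume "\<mu> > 0" "(\<lambda>c. vsub (w i) (w j) c / \<mu>) \<in> Q"
    then have "\<not> \<mu> < lam j" using separated[OF ijm ij(3), of \<mu>] by (auto simp: vsub_def)
    then show "s \<le> \<mu>" using size[OF ij(2)] by simp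
  qed
qed (use s q in auto)

text \<open>The members much larger than the smallest one all nearly have its centre \<open>w i0\<close> on their boundary;
  rescaling their centres relative to \<open>w i0\<close> gives a nearly separated subset of \<open>- Q\<close>.\<close>
lemma large_sizes_card:
  assumes S: "S \<subseteq> {..<m}" and i0: "i0 < m" and t: "t > 0"
    and refl: "\<And>x. x \<in> Q \<Longrightarrow> (\<lambda>c. - x c / t) \<in> Q" and d: "d > 0"
    and size: "\<And>i. i \<in> S \<Longrightarrow> real d * t * lam i0 \<le> lam i"
  shows "card S \<le> P_num d Q (2 * (1 + 1 / real d))"
proof (rule card_le_P_num)
  \<comment> \<open>Intersection with the homothet i0 gives w i0 - w i = lam i b + t lam i0 (-a/t),
    a combination of two points of Q with total weight \<alpha> i; dividing by that weight puts -u i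
    in Q.\<close>
  define \<alpha> where "\<alpha> i = lam i + t * lam i0" for i
  define u where "u i = (\<lambda>c. (w i c - w i0 c) / \<alpha> i)" for i
  have l0: "lam i0 > 0" using lam_pos[OF i0] .
  have \<alpha>: "\<alpha> i > 0" if "i < m" for i using lam_pos[OF that] t l0 by (simp add: \<alpha>_def add_pos_pos)
  have uQ: "(\<lambda>c. - u i c) \<in> Q" if i: "i < m" for i
  proof -
    obtain a b where ab: "a \<in> Q" "b \<in> Q" "\<And>c. w i0 c - w i c = lam i * b c - lam i0 * a c"
      using touching[OF i0 i] by blast
    have "(\<lambda>c. (lam i * b c + t * lam i0 * (- a c / t)) / \<alpha> i) \<in> Q"
      using t l0 lam_pos[OF i] \<alpha>[OF i]
      by (intro conic_mem[OF ab(2) refl[OF ab(1)], of "lam i" "t * lam i0" "\<alpha> i"]) (auto simp: \<alpha>_def)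
    also have "(\<lambda>c. (lam i * b c + t * lam i0 * (- a c / t)) / \<alpha> i) = (\<lambda>c. - u i c)"
    proof
      fix c show "(lam i * b c + t * lam i0 * (- a c / t)) / \<alpha> i = - u i c"
        using t by (simp add: u_def ab(3)[of c, symmetric] diff_divide_distrib)
    qed
    finally show ?thesis .
  qed
  show "finite S" using S finite_subset by blast
  \<comment> \<open>This fixes the scale s: d/(d + 1) bounds lam i / \<alpha> i from below, and 2(1
    + 1/d) times it is 2, the bound for differences of points of -Q.\<close>
  show "real d / (real d + 1) > 0" using d by simp
  show u_Rd: "u i \<in> Rd d" if "i \<in> S" for i using w_Rd[of i] w_Rd[OF i0] S that by (auto simp: Rd_def u_def)
  fix i j assume ij: "i \<in> S" "j \<in> S" "i \<noteq> j"
  then have ijm: "i < m" "j < m" using S by auto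
  show "gauge (half_diff Q) (vsub (u i) (u j)) \<le> 2 * (1 + 1 / real d) * (real d / (real d + 1))"
  proof -
    have "(\<lambda>c. (- u j c - - u i c) / 2) \<in> half_diff Q"
      by (rule half_diffI) (use uQ ijm in auto)
    then have "gauge (half_diff Q) (vsub (u i) (u j)) \<le> 2"
      by (intro gauge_le) (auto simp: set_scale_iff vsub_def)
    also have "2 = 2 * (1 + 1 / real d) * (real d / (real d + 1))"
    proof -
      have "1 + 1 / real d = (real d + 1) / real d" using d by (simp add: field_simps)
      then show ?thesis using d by (simp add: divide_eq_eq)
    qed
    finally show ?thesis .
  qed
  \<comment> \<open>If u i - u j = \<mu> y with y in Q, then w i - w j = \<alpha> i \<mu> y +
    (\<alpha> j - \<alpha> i)(-u j), where \<alpha> i \<le> \<alpha> j keeps the weights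
    nonnegative. Separation makes the total weight at least lam j, that is, \<alpha> i \<mu> \<ge>
    lam i.\<close>
  have key: "real d / (real d + 1) \<le> \<mu>"
    if "i \<in> S" "j \<in> S" "i \<noteq> j" "\<alpha> i \<le> \<alpha> j" "\<mu> > 0" "(\<lambda>c. (u i c - u j c) / \<mu>) \<in> Q" for i j \<mu>
  proof -
    have ijm: "i < m" "j < m" using that S by auto
    let ?\<nu> = "\<alpha> i * \<mu> + (\<alpha> j - \<alpha> i)"
    have \<nu>: "?\<nu> > 0" using \<alpha>[OF ijm(1)] that by (intro add_pos_nonneg) auto
    have "(\<lambda>c. (\<alpha> i * \<mu> * ((u i c - u j c) / \<mu>) + (\<alpha> j - \<alpha> i) * - u j c) / ?\<nu>) \<in> Q"
      using that \<alpha>[OF ijm(1)] \<nu>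
      by (intro conic_mem[OF that(6) uQ[OF ijm(2)], of "\<alpha> i * \<mu>" "\<alpha> j - \<alpha> i" ?\<nu>]) auto
    also have "(\<lambda>c. (\<alpha> i * \<mu> * ((u i c - u j c) / \<mu>) + (\<alpha> j - \<alpha> i) * - u j c) / ?\<nu>)
        = (\<lambda>c. (w i c - w j c) / ?\<nu>)"
    proof
      fix c
      have "w i c - w i0 c = \<alpha> i * u i c" "w j c - w i0 c = \<alpha> j * u j c"
        using \<alpha>[OF ijm(1)] \<alpha>[OF ijm(2)] by (auto simp: u_def)
      then have "w i c - w j c = \<alpha> i * u i c - \<alpha> j * u j c" by linarith
      moreover have "\<alpha> i * \<mu> * ((u i c - u j c) / \<mu>) = \<alpha> i * (u i c - u j c)" using that(5) by simp
      ultimately have "\<alpha> i * \<mu> * ((u i c - u j c) / \<mu>) + (\<alpha> j - \<alpha> i) * - u j c = w i c - w j c"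
        by (simp add: algebra_simps)
      then show "(\<alpha> i * \<mu> * ((u i c - u j c) / \<mu>) + (\<alpha> j - \<alpha> i) * - u j c) / ?\<nu> = (w i c - w j c) / ?\<nu>"
        by simp
    qed
    finally have "\<not> ?\<nu> < lam j" using separated[OF ijm that(3) \<nu>] by blast
    then have "\<alpha> i * \<mu> \<ge> lam i" by (simp add: \<alpha>_def)
    moreover have "lam i * (real d + 1) \<ge> real d * \<alpha> i"
      using size[OF that(1)] by (simp add: \<alpha>_def algebra_simps)
    ultimately have "real d * \<alpha> i \<le> \<alpha> i * \<mu> * (real d + 1)"
      by (meson mult_right_mono of_nat_0_le_iff add_nonneg_nonneg zero_le_one order_trans)
    then have "\<alpha> i * real d \<le> \<alpha> i * (\<mu> * (real d + 1))" by (simp add: algebra_simps)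
    then have "real d \<le> \<mu> * (real d + 1)" using \<alpha>[OF ijm(1)] by simp
    then show ?thesis by (simp add: divide_le_eq)
  qed
  show "real d / (real d + 1) \<le> gauge (sym_core Q) (vsub (u i) (u j))"
  proof (rule gauge_sym_core_ge)
    show "vsub (u i) (u j) \<in> Rd d" using u_Rd[OF ij(1)] u_Rd[OF ij(2)] by (auto simp: Rd_def vsub_def)
    fix \<mu> :: real assume \<mu>: "\<mu> > 0" "(\<lambda>c. vsub (u i) (u j) c / \<mu>) \<in> Q" "(\<lambda>c. - vsub (u i) (u j) c / \<mu>) \<in> Q"
    \<comment> \<open>The symmetric core supplies both signs, so the index with the smaller \<alpha>
      can be put first in \<open>key\<close>.\<close>
    then show "real d / (real d + 1) \<le> \<mu>"
      using key[of i j \<mu>] key[of j i \<mu>] ij by (cases "\<alpha> i \<le> \<alpha> j") (auto simp: vsub_def)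
  qed
qed auto

lemma arrangement_card:
  assumes t: "t > 0" and refl: "\<And>x. x \<in> Q \<Longrightarrow> (\<lambda>c. - x c / t) \<in> Q" and d: "d > 0"
    and N: "real d * t \<le> (1 + 1 / real d) ^ N"
  shows "m \<le> (N + 1) * P_num d Q (2 * (1 + 1 / real d))"
proof (cases "m = 0")
  case False
  define q where "q = 1 + 1 / real d"
  have q: "q > 1" using d by (simp add: q_def)
  have "finite {..<m}" "{..<m} \<noteq> {}" using False by auto
  then obtain i0 where i0: "i0 < m" "\<And>i. i < m \<Longrightarrow> lam i0 \<le> lam i"
    using ex_min_if_finite[of "lam ` {..<m}"] by (force simp: not_less)
  define small where "small k = {i. i < m \<and> q ^ k * lam i0 \<le> lam i \<and> lam i \<le> q * (q ^ k * lam i0)}" for k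
  define large where "large = {i. i < m \<and> q ^ N * lam i0 \<le> lam i}"
  have l0: "lam i0 > 0" using lam_pos[OF i0(1)] .
  have "i \<in> (\<Union>k<N. small k) \<union> large" if i: "i < m" for i
  proof -
    \<comment> \<open>An index not caught by the first n classes still has ratio at least
      \<open>q ^ n * lam i0\<close>; at n = N this reaches the threshold of the large group.\<close>
    have "i \<in> (\<Union>k<n. small k) \<or> q ^ n * lam i0 \<le> lam i" for n
    proof (induction n)
      case 0
      then show ?case using i0 i by simp
    next
      case (Suc n)
      then show ?case using i by (auto simp: small_def less_Suc_eq algebra_simps)
    qed
    from this[of N] show ?thesis using i by (auto simp: large_def)
  qed
  then have "card {..<m} \<le> card ((\<Union>k<N. small k) \<union> large)"
    by (intro card_mono) (auto simp: small_def large_def)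
  also have "\<dots> \<le> card (\<Union>k<N. small k) + card large" by (rule card_Un_le)
  also have "card (\<Union>k<N. small k) \<le> (\<Sum>k<N. card (small k))" by (rule card_UN_le) simp
  also have "\<dots> \<le> (\<Sum>k<N. P_num d Q (2 * q))"
  proof (rule sum_mono)
    fix k
    show "card (small k) \<le> P_num d Q (2 * q)"
      by (rule similar_sizes_card[of _ "q ^ k * lam i0"]) (use q l0 in \<open>auto simp: small_def\<close>)
  qed
  also have "card large \<le> P_num d Q (2 * q)"
    unfolding q_def
  proof (rule large_sizes_card[OF _ i0(1) t refl d])
    fix i assume "i \<in> large"
    moreover have "real d * t * lam i0 \<le> q ^ N * lam i0" using N l0 by (simp add: q_def)
    ultimately show "real d * t * lam i0 \<le> lam i" by (simp add: large_def)
  qed (auto simp: large_def)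
  finally show ?thesis by (simp add: q_def)
qed simp

end

end

subsection \<open>Arrangements with respect to an interior point\<close>

lemma interior_d_subset: "interior_d d K \<subseteq> K"
  by (force simp: interior_d_def enorm_def vsub_def)

text \<open>The ball of radius r about p, contracted towards k, becomes one of radius (1 - t) r
  about the combination.\<close>

lemma interior_d_convex_comb:
  assumes K: "convex_set K" "K \<subseteq> Rd d" and p: "p \<in> interior_d d K" and k: "k \<in> K"
    and t: "0 \<le> t" "t < 1"
  shows "(\<lambda>i. (1 - t) * p i + t * k i) \<in> interior_d d K" (is "?q \<in> _")
proof -
  obtain r where r: "r > 0" "\<And>y. y \<in> Rd d \<Longrightarrow> enorm d (vsub y p) < r \<Longrightarrow> y \<in> K"
    using p by (auto simp: interior_d_def)
  have pR: "p \<in> Rd d" using p by (auto simp: interior_d_def)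
  have kR: "k \<in> Rd d" using k K by auto
  have "y \<in> K" if y: "y \<in> Rd d" "enorm d (vsub y ?q) < (1 - t) * r" for y
  proof -
    \<comment> \<open>Chosen to solve (1 - t) z + t k = y.\<close>
    define z where "z i = p i + 1 / (1 - t) * (y i - ?q i)" for i
    have "enorm d (vsub z p) = 1 / (1 - t) * enorm d (vsub y ?q)"
      using enorm_scale[of d "1 / (1 - t)" "vsub y ?q"] t by (simp add: z_def vsub_def)
    also have "\<dots> < r" using y(2) t by (simp add: divide_less_eq mult.commute)
    finally have "z \<in> K" using r(2)[of z] y(1) pR kR by (auto simp: z_def Rd_def)
    from convex_setD[OF K(1) this k, of t] t have "(\<lambda>i. (1 - t) * z i + t * k i) \<in> K" by simp
    moreover have "(1 - t) * z i + t * k i = y i" for i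
    proof -
      have "(1 - t) * (1 / (1 - t) * (y i - ?q i)) = y i - ?q i" using t by simp
      then show ?thesis by (simp add: z_def distrib_left)
    qed
    ultimately show "y \<in> K" by simp
  qed
  moreover have "?q \<in> Rd d" using pR kR by (auto simp: Rd_def)
  moreover have "(1 - t) * r > 0" using r(1) t by simp
  ultimately show ?thesis unfolding interior_d_def by blast
qed

lemma translate_neg_iff: "x \<in> translate (vscale (-1) p) K \<longleftrightarrow> (\<lambda>i. x i + p i) \<in> K"
  by (simp add: translate_iff vscale_def)

lemma origin_body_translate:
  assumes K: "convex_body d K" and p: "p \<in> interior_d d K"
  obtains r R where "origin_body d (translate (vscale (-1) p) K) r R"
proof -
  have conv: "convex_set K" and K': "bounded_d d K" "K \<subseteq> Rd d"
    using K by (auto simp: convex_body_def)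
  obtain r where r: "r > 0" "\<And>y. y \<in> Rd d \<Longrightarrow> enorm d (vsub y p) < r \<Longrightarrow> y \<in> K"
    using p by (auto simp: interior_d_def)
  obtain R where R: "R > 0" "\<And>x i. x \<in> K \<Longrightarrow> \<bar>x i\<bar> \<le> R" using bounded_dD[OF K'] by blast
  have pK: "p \<in> K" and pR: "p \<in> Rd d" using p interior_d_subset K' by auto
  have "origin_body d (translate (vscale (-1) p) K) r (2 * R)"
  proof
    show "convex_set (translate (vscale (-1) p) K)"
      unfolding convex_set_def
    proof (intro ballI allI impI)
      fix x y t assume xy: "x \<in> translate (vscale (-1) p) K" "y \<in> translate (vscale (-1) p) K"
        and t: "0 \<le> t \<and> t \<le> (1::real)"
      have "(\<lambda>i. (1 - t) * (x i + p i) + t * (y i + p i)) \<in> K"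
        using xy t by (intro convex_setD[OF conv]) (auto simp: translate_neg_iff)
      then show "vadd (vscale (1 - t) x) (vscale t y) \<in> translate (vscale (-1) p) K"
        unfolding translate_neg_iff by (simp add: vadd_def vscale_def algebra_simps)
    qed
    show "translate (vscale (-1) p) K \<subseteq> Rd d"
    proof
      fix x assume "x \<in> translate (vscale (-1) p) K"
      then have "(\<lambda>i. x i + p i) \<in> Rd d" using K'(2) by (auto simp: translate_neg_iff)
      then show "x \<in> Rd d" using pR by (auto simp: Rd_def)
    qed
    show "x \<in> translate (vscale (-1) p) K" if "x \<in> Rd d" "enorm d x < r" for x
      unfolding translate_neg_iff using that pR by (intro r(2)) (auto simp: Rd_def vsub_def)
    show "\<bar>x i\<bar> \<le> 2 * R" if "x \<in> translate (vscale (-1) p) K" for x i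
      using R(2)[OF that[unfolded translate_neg_iff], of i] R(2)[OF pK, of i] by linarith
  qed (use r R in auto)
  then show thesis by (rule that)
qed

text \<open>With Q = K - p and w i = v i + lam i p, the homothet v i + lam i K equals w i + lam i Q,
  so the reference point becomes the origin.\<close>

lemma arrangement_bound:
  assumes K: "convex_body d K" and p: "p \<in> interior_d d K" and d: "d > 0"
    and t: "t > 0" and refl: "\<And>x. x \<in> K \<Longrightarrow> (\<lambda>i. p i - (x i - p i) / t) \<in> K"
    and N: "real d * t \<le> (1 + 1 / real d) ^ N"
    and arr: "minkowski_arr d K p m v lam" and pair: "pairwise_intersecting K m v lam"
  shows "m \<le> (N + 1) * P_num d (translate (vscale (-1) p) K) (2 * (1 + 1 / real d))"
proof -
  define Q where "Q = translate (vscale (-1) p) K"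
  obtain r R where "origin_body d Q r R" using origin_body_translate[OF K p] by (auto simp: Q_def)
  then interpret origin_body d Q r R .
  have conv: "convex_set K" and sub: "K \<subseteq> Rd d" using K by (auto simp: convex_body_def)
  have Q_iff: "x \<in> Q \<longleftrightarrow> (\<lambda>i. x i + p i) \<in> K" for x by (simp add: Q_def translate_neg_iff)
  have lam: "lam i > 0" and vR: "v i \<in> Rd d" if "i < m" for i
    using arr that by (auto simp: minkowski_arr_def)
  have sep: "(\<lambda>c. (v i c + lam i * p c - v j c) / lam j) \<notin> interior_d d K"
    if "i < m" "j < m" "i \<noteq> j" for i j
    using arr that lam[OF that(2)]
    by (auto simp: minkowski_arr_def translate_iff set_scale_iff vadd_def vscale_def)
  define w where "w i c = v i c + lam i * p c" for i c
  show ?thesis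
    unfolding Q_def[symmetric]
  proof (rule arrangement_card[where w = w and lam = lam and t = t])
    show "w i \<in> Rd d" if "i < m" for i
      using vR[OF that] p by (auto simp: w_def Rd_def interior_d_def)
    show "(\<lambda>c. (w i c - w j c) / \<mu>) \<notin> Q"
      if ij: "i < m" "j < m" "i \<noteq> j" and \<mu>: "0 < \<mu>" "\<mu> < lam j" for i j \<mu>
    proof
      assume "(\<lambda>c. (w i c - w j c) / \<mu>) \<in> Q"
      then have "(\<lambda>c. (w i c - w j c) / \<mu> + p c) \<in> K" by (simp add: Q_iff)
      \<comment> \<open>As \<mu> < lam j, the interior point p keeps positive weight, which upgrades
        membership in K to membership in the interior.\<close>
      from interior_d_convex_comb[OF conv sub p this, of "\<mu> / lam j"] \<mu>
      have "(\<lambda>c. (1 - \<mu> / lam j) * p c + \<mu> / lam j * ((w i c - w j c) / \<mu> + p c)) \<in> interior_d d K"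
        by simp
      also have "(\<lambda>c. (1 - \<mu> / lam j) * p c + \<mu> / lam j * ((w i c - w j c) / \<mu> + p c))
          = (\<lambda>c. (v i c + lam i * p c - v j c) / lam j)"
        using \<mu> by (auto simp: w_def fun_eq_iff field_simps)
      finally show False using sep[OF ij] by simp
    qed
    show "\<exists>a\<in>Q. \<exists>b\<in>Q. \<forall>c. w i c - w j c = lam j * b c - lam i * a c" if ij: "i < m" "j < m" for i j
    proof -
      from pair ij obtain x where "x \<in> translate (v i) (set_scale (lam i) K)"
        "x \<in> translate (v j) (set_scale (lam j) K)"
        unfolding pairwise_intersecting_def by blast
      then have x: "(\<lambda>c. (x c - v i c) / lam i) \<in> K" "(\<lambda>c. (x c - v j c) / lam j) \<in> K"
        using lam ij by (auto simp: translate_iff set_scale_iff)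
      show ?thesis
      proof (intro bexI allI)
        show "(\<lambda>c. (x c - v j c) / lam j - p c) \<in> Q" "(\<lambda>c. (x c - v i c) / lam i - p c) \<in> Q"
          using x by (auto simp: Q_iff)
        show "w i c - w j c = lam j * ((x c - v j c) / lam j - p c) - lam i * ((x c - v i c) / lam i - p c)" for c
        proof -
          have "lam k * (y / lam k - p c) = y - lam k * p c" if "k < m" for k y
            using lam[OF that] by (simp add: right_diff_distrib)
          then show ?thesis using ij by (simp add: w_def)
        qed
      qed
    qed
    show "(\<lambda>c. - x c / t) \<in> Q" if "x \<in> Q" for x
      using refl[OF that[unfolded Q_iff]] by (simp add: Q_iff algebra_simps)
  qed (use lam t d N in auto)
qed

text \<open>From ln (1 + 1/d) \<ge> 1 - d/(d + 1) = 1/(d + 1), the ceiling of (d + 1) ln x suffices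
  for N. Of the summand 2, one unit pays for rounding up, the other for the large group.\<close>

lemma exists_power_le:
  assumes "d > 0" "x \<ge> 1"
  obtains N where "x \<le> (1 + 1 / real d) ^ N" "real N + 1 \<le> (real d + 1) * ln x + 2"
proof
  let ?q = "1 + 1 / real d" and ?N = "nat \<lceil>(real d + 1) * ln x\<rceil>"
  have nn: "(real d + 1) * ln x \<ge> 0" using assms by simp
  have "- ln ?q = ln (inverse ?q)" by (simp only: ln_inverse)
  also have "\<dots> \<le> inverse ?q - 1" using assms by (intro ln_le_minus_one) (auto simp: add_pos_pos)
  finally have "1 - inverse ?q \<le> ln ?q" by simp
  moreover have "inverse ?q = real d / (real d + 1)" using assms by (simp add: divide_simps)
  ultimately have "1 - real d / (real d + 1) \<le> ln ?q" by metis
  then have "(real d + 1) * (1 - real d / (real d + 1)) \<le> (real d + 1) * ln ?q"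
    by (rule mult_left_mono) simp
  moreover have "(real d + 1) * (1 - real d / (real d + 1)) = 1" by (simp add: field_simps)
  ultimately have q: "1 \<le> (real d + 1) * ln ?q" by simp
  have "ln x \<le> ln x * ((real d + 1) * ln ?q)" using q assms mult_left_mono[of 1 _ "ln x"] by simp
  also have "\<dots> = (real d + 1) * ln x * ln ?q" by simp
  also have "\<dots> \<le> real ?N * ln ?q"
    using assms nn by (intro mult_right_mono) (auto intro: real_nat_ceiling_ge)
  also have "\<dots> = ln (?q ^ ?N)" using assms by (simp add: ln_realpow add_pos_pos)
  finally show "x \<le> ?q ^ ?N" using assms by (subst (asm) ln_le_cancel_iff) (auto simp: add_pos_pos)
  show "real ?N + 1 \<le> (real d + 1) * ln x + 2" using nn by linarith
qed

lemma kappa_bound: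
  assumes K: "convex_body d K" and p: "p \<in> interior_d d K" and d: "d \<ge> 2"
    and t: "real d * t \<ge> 1" and refl: "\<And>x. x \<in> K \<Longrightarrow> (\<lambda>i. p i - (x i - p i) / t) \<in> K"
  shows "bdd_above {m. \<exists>v lam. minkowski_arr d K p m v lam \<and> pairwise_intersecting K m v lam}"
    and "real (kappa d K p) \<le> real (P_num d (translate (vscale (-1) p) K) (2 * (1 + 1 / real d)))
      * ((real d + 1) * ln (real d * t) + 2)"
proof -
  let ?A = "{m. \<exists>v lam. minkowski_arr d K p m v lam \<and> pairwise_intersecting K m v lam}"
  let ?P = "P_num d (translate (vscale (-1) p) K) (2 * (1 + 1 / real d))"
  have t0: "t > 0" using t by (metis linorder_not_less mult_nonneg_nonpos not_one_le_zero of_nat_0_le_iff order_trans)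
  obtain N where N: "real d * t \<le> (1 + 1 / real d) ^ N" "real N + 1 \<le> (real d + 1) * ln (real d * t) + 2"
    using exists_power_le[of d "real d * t"] d t by auto
  have bound: "m \<le> (N + 1) * ?P" if "m \<in> ?A" for m
    using that arrangement_bound[OF K p _ t0 refl N(1)] d by auto
  show "bdd_above ?A" using bound by (rule bdd_aboveI)
  have "minkowski_arr d K p 0 v lam" "pairwise_intersecting K 0 v lam" for v lam
    by (simp_all add: minkowski_arr_def pairwise_intersecting_def)
  then have "0 \<in> ?A" by blast
  then have "kappa d K p \<le> (N + 1) * ?P"
    unfolding kappa_def using bound by (intro cSup_least) auto
  then have "real (kappa d K p) \<le> real ((N + 1) * ?P)" by (rule of_nat_mono)
  also have "\<dots> = real ?P * (real N + 1)" by (simp add: algebra_simps)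
  also have "\<dots> \<le> real ?P * ((real d + 1) * ln (real d * t) + 2)"
    using N(2) by (rule mult_left_mono) simp
  finally show "real (kappa d K p) \<le> real ?P * ((real d + 1) * ln (real d * t) + 2)" .
qed

text \<open>Strict arrangements are arrangements because the interior lies in K; boundedness of the
  larger set lets \<open>Sup\<close> on naturals respect the inclusion.\<close>

lemma kappa'_le_kappa:
  assumes "bdd_above {m. \<exists>v lam. minkowski_arr d K p m v lam \<and> pairwise_intersecting K m v lam}"
  shows "kappa' d K p \<le> kappa d K p"
  unfolding kappa'_def kappa_def
proof (rule cSup_subset_mono)
  have "strict_minkowski_arr d K p 0 v lam" "pairwise_intersecting K 0 v lam" for v lam
    by (simp_all add: strict_minkowski_arr_def pairwise_intersecting_def)
  then show "{m. \<exists>v lam. strict_minkowski_arr d K p m v lam \<and> pairwise_intersecting K m v lam} \<noteq> {}"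
    by blast
  have "translate x (set_scale t (interior_d d K)) \<subseteq> translate x (set_scale t K)" for x t
    unfolding translate_def set_scale_def by (intro image_mono interior_d_subset)
  then have "minkowski_arr d K p m v lam" if "strict_minkowski_arr d K p m v lam" for m v lam
    using that unfolding minkowski_arr_def strict_minkowski_arr_def by blast
  then show "{m. \<exists>v lam. strict_minkowski_arr d K p m v lam \<and> pairwise_intersecting K m v lam}
      \<subseteq> {m. \<exists>v lam. minkowski_arr d K p m v lam \<and> pairwise_intersecting K m v lam}" by blast
qed (rule assms)

subsection \<open>The asymmetry parameter\<close>

lemma reflection_iff:
  assumes "t > 0"
  shows "(\<lambda>x. vsub origin x) ` K \<subseteq> set_scale t ((\<lambda>x. vsub x origin) ` K)
    \<longleftrightarrow> (\<forall>x\<in>K. (\<lambda>i. - x i / t) \<in> K)"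
  using assms by (auto simp: set_scale_iff vsub_def origin_def)

text \<open>For t < 1, iterating division by -t from a nonzero point of K would leave every bounded
  set.\<close>

lemma reflection_ge_one:
  assumes K: "origin_body d K r R" and d: "d > 0" and t: "t > 0"
    and refl: "\<forall>x\<in>K. (\<lambda>i. - x i / t) \<in> K"
  shows "t \<ge> 1"
proof (rule ccontr)
  interpret origin_body d K r R by fact
  assume "\<not> t \<ge> 1"
  define e where "e = (\<lambda>i. if i = (0::nat) then r / 2 else (0::real))"
  have "enorm d e = r / 2"
    using d r_pos by (simp add: enorm_def e_def if_distrib[of "\<lambda>x. x\<^sup>2"] cong: if_cong)
  then have e: "e \<in> K" using d r_pos by (intro ball) (auto simp: e_def Rd_def)
  have iter: "(\<lambda>i. (- 1 / t) ^ n * e i) \<in> K" for n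
  proof (induction n)
    case (Suc n)
    from bspec[OF refl Suc] show ?case by (simp add: mult_ac)
  qed (use e in simp)
  have "(1 / t) ^ n \<le> R / (r / 2)" for n
  proof -
    have "\<bar>(- 1 / t) ^ n * e 0\<bar> \<le> R" using bounded[OF iter, of n 0] .
    then show ?thesis using t r_pos by (simp add: e_def abs_mult power_abs le_divide_eq)
  qed
  moreover obtain n where "R / (r / 2) < (1 / t) ^ n"
    using real_arch_pow[of "1 / t" "R / (r / 2)"] \<open>\<not> t \<ge> 1\<close> t by auto
  ultimately show False by (simp add: not_less[symmetric])
qed

text \<open>The factor c > 1 avoids asking whether the infimum is attained: as \<open>theta\<close>
  is at least 1, c times it is strictly larger, so some admissible t lies below.\<close>

lemma theta_approx:
  assumes K: "origin_body d K r R" and d: "d > 0"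
  shows "theta K origin \<ge> 1"
    and "\<And>c. c > 1 \<Longrightarrow> \<exists>t. 1 \<le> t \<and> t \<le> c * theta K origin \<and> (\<forall>x\<in>K. (\<lambda>i. - x i / t) \<in> K)"
proof -
  interpret origin_body d K r R by fact
  define T where "T = {t. t > 0 \<and> (\<lambda>x. vsub origin x) ` K \<subseteq> set_scale t ((\<lambda>x. vsub x origin) ` K)}"
  have th: "theta K origin = Inf T" by (simp add: theta_def T_def)
  have T_iff: "t \<in> T \<longleftrightarrow> t > 0 \<and> (\<forall>x\<in>K. (\<lambda>i. - x i / t) \<in> K)" for t
    using reflection_iff[of t K] by (auto simp: T_def)
  have T_ge: "t \<ge> 1" if "t \<in> T" for t
    using that reflection_ge_one[OF K d] by (simp add: T_iff)
  \<comment> \<open>All of K lies in this multiple of its symmetric core, hence so does -K, and the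
    infimum is over a nonempty set.\<close>
  have "(real d + 1) / r * R \<in> T"
  proof -
    let ?c = "(real d + 1) / r * R"
    have c: "?c > 0" using r_pos R_pos by simp
    have "(\<lambda>i. - x i / ?c) \<in> K" if "x \<in> K" for x
    proof -
      have "x \<in> set_scale ?c (sym_core K)"
        using that sub_Rd R_pos bounded by (intro sym_core_scale) auto
      then have "(\<lambda>i. - (x i / ?c)) \<in> K" unfolding set_scale_iff[OF c] sym_core_iff by blast
      then show ?thesis by (simp only: minus_divide_left)
    qed
    then show ?thesis using c by (simp add: T_iff)
  qed
  then have ne: "T \<noteq> {}" by blast
  show th1: "theta K origin \<ge> 1" unfolding th using ne T_ge by (rule cInf_greatest)
  fix c :: real assume "c > 1"
  then have "Inf T < c * theta K origin" using th1 by (simp add: th)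
  then obtain t where "t \<in> T" "t < c * theta K origin" using cInf_lessD[OF ne] by blast
  then show "\<exists>t. 1 \<le> t \<and> t \<le> c * theta K origin \<and> (\<forall>x\<in>K. (\<lambda>i. - x i / t) \<in> K)"
    using T_ge by (intro exI[of _ t]) (auto simp: T_iff)
qed

text \<open>The centroid c sits at parameter d/(d + 1) < 1 on the segment from an interior point z
  to the point c + (c - z)/d of K.\<close>

lemma centroid_interior:
  assumes K: "convex_body d K" and d: "d > 0"
  shows "centroid d K \<in> interior_d d K"
proof -
  have conv: "convex_set K" and sub: "K \<subseteq> Rd d" and "interior_d d K \<noteq> {}"
    using K by (auto simp: convex_body_def)
  then obtain z where z: "z \<in> interior_d d K" by blast
  let ?c = "centroid d K"
  have "(\<lambda>i. ?c i + (?c i - z i) / real d) \<in> K"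
    using centroid_reflection[OF K _ d] z interior_d_subset by blast
  from interior_d_convex_comb[OF conv sub z this, of "real d / (real d + 1)"]
  have "(\<lambda>i. (1 - real d / (real d + 1)) * z i + real d / (real d + 1) * (?c i + (?c i - z i) / real d))
      \<in> interior_d d K" by simp
  also have "(\<lambda>i. (1 - real d / (real d + 1)) * z i + real d / (real d + 1) * (?c i + (?c i - z i) / real d)) = ?c"
  proof
    fix i
    have "1 - real d / (real d + 1) = 1 / (real d + 1)" by (simp add: field_simps)
    moreover have "real d * (?c i + (?c i - z i) / real d) = (real d + 1) * ?c i - z i"
      using d by (simp add: field_simps)
    ultimately show "(1 - real d / (real d + 1)) * z i + real d / (real d + 1) * (?c i + (?c i - z i) / real d) = ?c i"
      by (simp add: add_divide_distrib[symmetric])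
  qed
  finally show ?thesis .
qed

text \<open>Absorbs additive constants into multiples of ln d.\<close>

lemma one_le_2_ln:
  assumes "d \<ge> (2::nat)"
  shows "1 \<le> 2 * ln (real d)"
proof -
  have "1 / 2 \<le> ln (2::real)" using ln2_ge_two_thirds by simp
  also have "\<dots> \<le> ln (real d)" using assms by simp
  finally show ?thesis by simp
qed

section \<open>Both bounds with one absolute constant\<close>

theorem theorem15:
  shows "\<exists>C::real. \<forall>d::nat. \<forall>K. d \<ge> 2 \<and> convex_body d K \<and> origin \<in> interior_d d K \<longrightarrow>
    kappa' d K origin \<le> kappa d K origin \<and>
    real (kappa d K origin) \<le> real (P_num d K (2 * (1 + 1 / real d))) * (real d + C)
        * (ln (real d) + ln (theta K origin)) \<and>
    real (kappa d K (centroid d K)) \<le>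
        real (P_num d (translate (vscale (-1) (centroid d K)) K) (2 * (1 + 1 / real d)))
        * (2 * real d + C) * ln (real d)"
proof (intro exI[of _ 8] allI impI conjI; elim conjE)
  fix d :: nat and K
  assume d: "d \<ge> 2" and K: "convex_body d K" and o: "origin \<in> interior_d d K"
  let ?M = "2 * (1 + 1 / real d)" and ?L = "ln (real d)"
  \<comment> \<open>Origin of the constant 8: the first bound leaves 3 + 1/d \<le> 7/2 \<le> 7 ln d
    on top of the coefficient d + 1; the second needs only 2 ln d + 2 \<le> 6 ln d on top of 2 d ln
    d.\<close>
  have L: "1 \<le> 2 * ?L" using one_le_2_ln[OF d] .
  have K0: "translate (vscale (-1) origin) K = K"
    by (rule set_eqI) (simp add: translate_neg_iff origin_def)
  obtain r R where OB: "origin_body d K r R" using origin_body_translate[OF K o] by (auto simp: K0)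
  let ?T = "theta K origin"
  have \<theta>: "?T \<ge> 1" by (rule theta_approx[OF OB]) (use d in simp)
  \<comment> \<open>The factor 1 + 1/d costs ln (1 + 1/d) \<le> 1/d, which stays bounded after
    multiplication by d + 1; a fixed factor would cost an amount linear in d.\<close>
  obtain t where t: "1 \<le> t" "t \<le> (1 + 1 / real d) * ?T" "\<And>x. x \<in> K \<Longrightarrow> (\<lambda>i. - x i / t) \<in> K"
    using theta_approx(2)[OF OB, of "1 + 1 / real d"] d by auto
  have dt: "real d * t \<ge> 1" using d t(1) mult_mono[of 1 "real d" 1 t] by simp
  have refl: "(\<lambda>i. origin i - (x i - origin i) / t) \<in> K" if "x \<in> K" for x
    using t(3)[OF that] by (simp add: origin_def)
  note bd = kappa_bound[OF K o d dt refl]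
  show "kappa' d K origin \<le> kappa d K origin" using bd(1) by (rule kappa'_le_kappa)
  have "ln (real d * t) \<le> ln (real d * ((1 + 1 / real d) * ?T))"
    using d t(1,2) by (intro ln_mono) auto
  also have "\<dots> = ?L + ln ?T + ln (1 + 1 / real d)"
    using d \<theta> ln_mult_pos[of "real d" "(1 + 1 / real d) * ?T"] ln_mult_pos[of "1 + 1 / real d" ?T]
    by (simp add: add_pos_pos)
  also have "\<dots> \<le> ?L + ln ?T + 1 / real d"
    using ln_add_one_self_le_self[of "1 / real d"] by simp
  finally have "(real d + 1) * ln (real d * t) \<le> (real d + 1) * (?L + ln ?T + 1 / real d)"
    by (intro mult_left_mono) auto
  also have "\<dots> = (real d + 1) * (?L + ln ?T) + (1 + 1 / real d)"
    using d by (simp add: field_simps)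
  also have "\<dots> \<le> (real d + 1) * (?L + ln ?T) + (7 * ?L - 2)"
  proof -
    have "1 / real d \<le> 1 / 2" using d by (simp add: field_simps)
    then show ?thesis using L by linarith
  qed
  finally have "(real d + 1) * ln (real d * t) + 2 \<le> (real d + 1) * (?L + ln ?T) + 7 * ?L"
    by simp
  also have "\<dots> \<le> (real d + 8) * (?L + ln ?T)"
    using ln_ge_zero[OF \<theta>] by (simp add: distrib_right distrib_left)
  finally have "(real d + 1) * ln (real d * t) + 2 \<le> (real d + 8) * (?L + ln ?T)" .
  then have "real (P_num d K ?M) * ((real d + 1) * ln (real d * t) + 2)
      \<le> real (P_num d K ?M) * ((real d + 8) * (?L + ln ?T))"
    by (rule mult_left_mono) simp
  with bd(2) show "real (kappa d K origin) \<le> real (P_num d K ?M) * (real d + 8) * (?L + ln ?T)"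
    by (simp add: K0 mult.assoc)
  let ?c = "centroid d K" and ?P = "P_num d (translate (vscale (-1) (centroid d K)) K) ?M"
  \<comment> \<open>Here t = d, so the logarithm is ln (d d) = 2 ln d, the source of the leading
    2d.\<close>
  have "(\<lambda>i. ?c i - (x i - ?c i) / real d) \<in> K" if "x \<in> K" for x
  proof -
    have eq: "?c i - (x i - ?c i) / real d = ?c i + (?c i - x i) / real d" for i
      by (simp add: diff_divide_distrib)
    have "(\<lambda>i. ?c i + (?c i - x i) / real d) \<in> K" using centroid_reflection[OF K that] d by simp
    then show ?thesis by (simp only: eq)
  qed
  moreover have "real d * real d \<ge> 1" using d mult_mono[of 1 "real d" 1 "real d"] by simp
  moreover have "?c \<in> interior_d d K" using centroid_interior[OF K] d by simp
  ultimately have "real (kappa d K ?c) \<le> real ?P * ((real d + 1) * ln (real d * real d) + 2)"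
    using kappa_bound(2)[OF K _ d] by blast
  also have "\<dots> \<le> real ?P * ((2 * real d + 8) * ?L)"
    using d L by (intro mult_left_mono) (auto simp: ln_mult algebra_simps)
  finally show "real (kappa d K ?c) \<le> real ?P * (2 * real d + 8) * ?L" by (simp add: mult.assoc)
qed

end
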